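(* Let $G_{\mathbb{C}}=SO(7,\mathbb{C})$, $H_{\mathbb{C}}=G_2(\mathbb{C})$ and $G_u=SO(7)$, with Lie algebras $\mathfrak{g},\mathfrak{h},\mathfrak{g}_u$, and let $\mathfrak{q}$ be the orthogonal complement of $\mathfrak{h}$ in $\mathfrak{g}$ with respect to the Killing form of $\mathfrak{g}$. Let $$\mathfrak{a}_0=\{\operatorname{diag}(O_2,\delta_t,\delta_t,\delta_t):t\in\mathbb{R}\},\qquad \delta_t=\begin{pmatrix}0&-\sqrt{-1}\,t\\\sqrt{-1}\,t&0\end{pmatrix},$$ where $O_2$ is the $2\times2$ zero matrix. Then $\mathfrak{a}_0\subset\sqrt{-1}\,\mathfrak{g}_u\cap\mathfrak{q}$, and the one-dimensional abelian group $A_0=\exp\mathfrak{a}_0$ satisfies $$G_{\mathbb{C}}=G_uA_0H_{\mathbb{C}}.$$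
   Context: Cayley algebra: $\mathfrak{C}$ is the 8-dimensional real algebra with basis $e_0,\dots,e_7$, where $e_0$ is the unit, $e_i^2=-e_0$ for $i\ge 1$, $e_ie_j=-e_je_i$ for distinct $i,j\geq 1$, and $e_1e_2=e_3$, $e_1e_4=e_5$, $e_1e_6=e_7$, $e_2e_5=e_7$, $e_2e_6=e_4$, $e_3e_5=e_6$, $e_3e_4=e_7$ (each listed relation $e_ie_j=e_k$ also gives $e_je_k=e_i$ and $e_ke_i=e_j$). $\mathfrak{C}_{\mathbb{C}}=\mathfrak{C}\otimes_{\mathbb{R}}\mathbb{C}$ carries the complex symmetric bilinear form with $(e_i,e_j)=\delta_{ij}$. $SO(8,\mathbb{C})=\{g\in SL(8,\mathbb{C}):{}^tgg=I_8\}$ acts on $\mathfrak{C}_{\mathbb{C}}$ via the ordered basis $e_0,\dots,e_7$. $SO(7,\mathbb{C})=\{g\in SO(8,\mathbb{C}):ge_0=e_0\}$ (so its elements are written as $8\times 8$ matrices), and $SO(7)$ is its subgroup of real matrices, i.e. the fixed point group of the Cartan involution $g\mapsto\overline{g}$. $G_2(\mathbb{C})=\{g\in SO(8,\mathbb{C}):(gx)(gy)=g(xy)\ \forall x,y\in\mathfrak{C}_{\mathbb{C}}\}\subset SO(7,\mathbb{C})$. Here $\operatorname{diag}$ denotes a block-diagonal matrix. *)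

theory Defs
  imports "HOL-Analysis.Analysis" "HOL-Algebra.Group"
begin

text \<open>
  Vectors and matrices are indexed by the type \<open>8\<close> (the residues \<open>0, \<dots>, 7\<close>), so that
  \<open>axis i 1\<close> is the basis vector \<open>e\<^sub>i\<close> and \<open>g *v axis j 1\<close> is the column of \<open>g\<close> with
  index \<open>j\<close>.
\<close>

section \<open>The Cayley algebra\<close>

text \<open>The triples \<open>(i, j, k)\<close> of distinct indices \<open>\<noteq> 0\<close> with \<open>e\<^sub>i e\<^sub>j = e\<^sub>k\<close>.\<close>

definition cayley_triples :: "(8 \<times> 8 \<times> 8) set" where
  "cayley_triples =
    (\<Union>(i, j, k) \<in> {(1,2,3), (1,4,5), (1,6,7), (2,5,7), (2,6,4), (3,5,6), (3,4,7)}.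
       {(i, j, k), (j, k, i), (k, i, j)})"

text \<open>The coefficient of \<open>e\<^sub>k\<close> in the product \<open>e\<^sub>i e\<^sub>j\<close>.\<close>

definition cayley_coeff :: "8 \<Rightarrow> 8 \<Rightarrow> 8 \<Rightarrow> int" where
  "cayley_coeff i j k =
    (if i = 0 then (if k = j then 1 else 0)
     else if j = 0 then (if k = i then 1 else 0)
     else if i = j then (if k = 0 then - 1 else 0)
     else if (i, j, k) \<in> cayley_triples then 1
     else if (j, i, k) \<in> cayley_triples then - 1
     else 0)"

text \<open>
  For \<open>'a = real\<close> this is the product of the Cayley algebra, for \<open>'a = complex\<close> that of its
  complexification.
\<close>

definition cayley_mult :: "'a::comm_ring_1 ^ 8 \<Rightarrow> 'a ^ 8 \<Rightarrow> 'a ^ 8"  (infixl \<open>\<cdot>\<^sub>C\<close> 70) where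
  "x \<cdot>\<^sub>C y = (\<chi> k. \<Sum>i\<in>UNIV. \<Sum>j\<in>UNIV. of_int (cayley_coeff i j k) * x $ i * y $ j)"


section \<open>The groups\<close>

definition SO8C :: "(complex ^ 8 ^ 8) set" where
  "SO8C = {g. det g = 1 \<and> transpose g ** g = mat 1}"

definition SO7C :: "(complex ^ 8 ^ 8) set" where
  "SO7C = {g \<in> SO8C. g *v axis 0 1 = axis 0 1}"

definition SO7 :: "(complex ^ 8 ^ 8) set" where
  "SO7 = {g \<in> SO7C. \<forall>i j. g $ i $ j \<in> \<real>}"

definition G2C :: "(complex ^ 8 ^ 8) set" where
  "G2C = {g \<in> SO8C. \<forall>x y. (g *v x) \<cdot>\<^sub>C (g *v y) = g *v (x \<cdot>\<^sub>C y)}"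

definition matrix_monoid :: "('a::semiring_1 ^ 'n ^ 'n) set \<Rightarrow> ('a ^ 'n ^ 'n) monoid" where
  "matrix_monoid S = \<lparr>carrier = S, monoid.mult = (**), one = mat 1\<rparr>"


section \<open>Lie algebras of matrix groups\<close>

text \<open>
  The multiplication of the type class \<open>times\<close> on \<open>complex ^ 'n ^ 'n\<close> is componentwise, so the
  library's \<open>exp\<close> and \<open>power\<close> do not provide the exponential and the powers of a matrix.
\<close>

definition mat_exp :: "complex ^ 'n ^ 'n \<Rightarrow> complex ^ 'n ^ 'n" where
  "mat_exp X = (\<Sum>k. inverse (fact k) *\<^sub>R (((**) X) ^^ k) (mat 1))"

definition lie_algebra :: "(complex ^ 'n ^ 'n) set \<Rightarrow> (complex ^ 'n ^ 'n) set" where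
  "lie_algebra G = {X. \<forall>t::real. mat_exp (t *\<^sub>R X) \<in> G}"

definition bracket :: "complex ^ 'n ^ 'n \<Rightarrow> complex ^ 'n ^ 'n \<Rightarrow> complex ^ 'n ^ 'n" where
  "bracket X Y = X ** Y - Y ** X"

definition cscale :: "complex \<Rightarrow> complex ^ 'n ^ 'm \<Rightarrow> complex ^ 'n ^ 'm" where
  "cscale c = map_matrix ((*) c)"

global_interpretation cmat: vector_space "cscale :: complex \<Rightarrow> complex ^ 'n ^ 'm \<Rightarrow> _"
  by unfold_locales (simp_all add: cscale_def vec_eq_iff algebra_simps)

text \<open>
  The complex trace of a linear endomorphism of a complex subspace \<open>V\<close>; it does not depend on
  the choice of the basis \<open>B\<close>.
\<close>

definition trace_on :: "(complex ^ 'n ^ 'n) set \<Rightarrow> (complex ^ 'n ^ 'n \<Rightarrow> complex ^ 'n ^ 'n) \<Rightarrow> complex"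
  where
  "trace_on V f =
    (let B = (SOME B. B \<subseteq> V \<and> cmat.independent B \<and> cmat.span B = V)
     in \<Sum>b\<in>B. cmat.representation B (f b) b)"

definition killing_form ::
    "(complex ^ 'n ^ 'n) set \<Rightarrow> complex ^ 'n ^ 'n \<Rightarrow> complex ^ 'n ^ 'n \<Rightarrow> complex" where
  "killing_form L X Y = trace_on L (\<lambda>Z. bracket X (bracket Y Z))"

definition killing_complement ::
    "(complex ^ 'n ^ 'n) set \<Rightarrow> (complex ^ 'n ^ 'n) set \<Rightarrow> (complex ^ 'n ^ 'n) set" where
  "killing_complement L M = {X \<in> L. \<forall>Y\<in>M. killing_form L X Y = 0}"


section \<open>The abelian subspace\<close>

text \<open>
  The block diagonal matrix with diagonal blocks \<open>O\<^sub>2, \<delta>\<^sub>t, \<delta>\<^sub>t, \<delta>\<^sub>t\<close>, which occupy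
  the rows and columns \<open>{0, 1}\<close>, \<open>{2, 3}\<close>, \<open>{4, 5}\<close>, \<open>{6, 7}\<close>.
\<close>

definition diag_delta :: "real \<Rightarrow> complex ^ 8 ^ 8" where
  "diag_delta t = (\<chi> i j.
     if (i, j) \<in> {(2,3), (4,5), (6,7)} then - \<i> * complex_of_real t
     else if (i, j) \<in> {(3,2), (5,4), (7,6)} then \<i> * complex_of_real t
     else 0)"

definition \<aa>\<^sub>0 :: "(complex ^ 8 ^ 8) set" where
  "\<aa>\<^sub>0 = range diag_delta"

definition A\<^sub>0 :: "(complex ^ 8 ^ 8) set" where
  "A\<^sub>0 = mat_exp ` \<aa>\<^sub>0"

end

theory Submission
  imports Defs
begin

text \<open>
  Left multiplication \<open>L\<^sub>u\<close> by an imaginary unit \<open>u\<close> satisfies \<open>L\<^sub>u\<^sup>2 = - 1\<close>, so the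
  \<open>L\<^sub>u\<close> generate the spin representation on the Cayley algebra, and \<open>L\<^sub>u (x y) = (c\<^sub>u x) (L\<^sub>u y)\<close>
  for the half turn \<open>c\<^sub>u\<close> about \<open>u\<close>. Half turns generate \<open>SO(7, \<complex>)\<close>; hence every \<open>g\<close> in
  \<open>SO(7, \<complex>)\<close> has an orthogonal lift \<open>M\<close> with \<open>M (x y) = (g x) (M y)\<close>, and \<open>g\<close> is in \<open>G\<^sub>2\<close> as
  soon as the spinor \<open>M e\<^sub>0\<close> is \<open>e\<^sub>0\<close>. The real and imaginary parts of \<open>M e\<^sub>0\<close> are orthogonal, and
  the difference of their squared norms is 1. Since the real lifts move every orthogonal pair
  of vectors of \<open>\<real>\<^sup>8\<close> into the lines of \<open>e\<^sub>0\<close> and \<open>e\<^sub>1\<close>, the spinor can be brought to the form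
  \<open>cosh \<tau> e\<^sub>0 + \<i> sinh \<tau> e\<^sub>1\<close>, which is the spinor of an element of \<open>A\<^sub>0\<close>.

  The Killing form of \<open>so(7, \<complex>)\<close> is \<open>5 tr(X Y)\<close>, and it pairs \<open>\<aa>\<^sub>0\<close> with a derivation \<open>Y\<close> to a multiple
  of \<open>Y\<^bsub>32\<^esub> + Y\<^bsub>54\<^esub> + Y\<^bsub>76\<^esub>\<close>, which vanishes by the derivation rule for \<open>e\<^sub>2 e\<^sub>4 = - e\<^sub>6\<close>.
\<close>

section \<open>The Cayley algebra and its left multiplications\<close>

lemma exhaust_8:
  fixes x :: 8
  shows "x = 0 \<or> x = 1 \<or> x = 2 \<or> x = 3 \<or> x = 4 \<or> x = 5 \<or> x = 6 \<or> x = 7"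
proof (induct x)
  case (of_int z)
  then have "0 \<le> z" and "z < 8" by simp_all
  then have "z = 0 \<or> z = 1 \<or> z = 2 \<or> z = 3 \<or> z = 4 \<or> z = 5 \<or> z = 6 \<or> z = 7" by arith
  then show ?case by auto
qed

lemma UNIV_8: "UNIV = {0, 1, 2, 3, 4, 5, 6, 7 :: 8}"
  using exhaust_8 by auto

lemma forall_8: "(\<forall>i::8. P i) \<longleftrightarrow> P 0 \<and> P 1 \<and> P 2 \<and> P 3 \<and> P 4 \<and> P 5 \<and> P 6 \<and> P 7"
  by (metis exhaust_8)

lemma sum_8: "sum f (UNIV :: 8 set) = f 0 + f 1 + f 2 + f 3 + f 4 + f 5 + f 6 + f 7"
  unfolding UNIV_8 by (simp add: ac_simps)

text \<open>The coefficient sums are expanded once, so that later coordinate checks become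
  polynomial identities in eight variables.\<close>

lemma cayley_mult_component:
  fixes x y :: "'a::comm_ring_1 ^ 8"
  shows "(x \<cdot>\<^sub>C y) $ 0 = x $ 0 * y $ 0 - x $ 1 * y $ 1 - x $ 2 * y $ 2 - x $ 3 * y $ 3
      - x $ 4 * y $ 4 - x $ 5 * y $ 5 - x $ 6 * y $ 6 - x $ 7 * y $ 7"
    and "(x \<cdot>\<^sub>C y) $ 1 = x $ 0 * y $ 1 + x $ 1 * y $ 0 + x $ 2 * y $ 3 - x $ 3 * y $ 2
      + x $ 4 * y $ 5 - x $ 5 * y $ 4 + x $ 6 * y $ 7 - x $ 7 * y $ 6"
    and "(x \<cdot>\<^sub>C y) $ 2 = x $ 0 * y $ 2 + x $ 2 * y $ 0 + x $ 3 * y $ 1 - x $ 1 * y $ 3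
      + x $ 5 * y $ 7 - x $ 7 * y $ 5 + x $ 6 * y $ 4 - x $ 4 * y $ 6"
    and "(x \<cdot>\<^sub>C y) $ 3 = x $ 0 * y $ 3 + x $ 3 * y $ 0 + x $ 1 * y $ 2 - x $ 2 * y $ 1
      + x $ 5 * y $ 6 - x $ 6 * y $ 5 + x $ 4 * y $ 7 - x $ 7 * y $ 4"
    and "(x \<cdot>\<^sub>C y) $ 4 = x $ 0 * y $ 4 + x $ 4 * y $ 0 + x $ 5 * y $ 1 - x $ 1 * y $ 5
      + x $ 2 * y $ 6 - x $ 6 * y $ 2 + x $ 7 * y $ 3 - x $ 3 * y $ 7"
    and "(x \<cdot>\<^sub>C y) $ 5 = x $ 0 * y $ 5 + x $ 5 * y $ 0 + x $ 1 * y $ 4 - x $ 4 * y $ 1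
      + x $ 7 * y $ 2 - x $ 2 * y $ 7 + x $ 6 * y $ 3 - x $ 3 * y $ 6"
    and "(x \<cdot>\<^sub>C y) $ 6 = x $ 0 * y $ 6 + x $ 6 * y $ 0 + x $ 7 * y $ 1 - x $ 1 * y $ 7
      + x $ 4 * y $ 2 - x $ 2 * y $ 4 + x $ 3 * y $ 5 - x $ 5 * y $ 3"
    and "(x \<cdot>\<^sub>C y) $ 7 = x $ 0 * y $ 7 + x $ 7 * y $ 0 + x $ 1 * y $ 6 - x $ 6 * y $ 1
      + x $ 2 * y $ 5 - x $ 5 * y $ 2 + x $ 3 * y $ 4 - x $ 4 * y $ 3"
  unfolding cayley_mult_def
  by (simp_all add: sum_8 cayley_coeff_def cayley_triples_def)

text \<open>Bilinear, without conjugation, also over the complex numbers; nonzero isotropic vectors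
  exist there, so normalizing a vector needs a hypothesis.\<close>

definition dot :: "'a::comm_ring_1 ^ 'n \<Rightarrow> 'a ^ 'n \<Rightarrow> 'a" where
  "dot x y = (\<Sum>i\<in>UNIV. x $ i * y $ i)"

text \<open>Moving a factor \<open>u\<close> across the form and then applying
  \<open>cayley_clifford_square\<close> shows that left multiplication by an imaginary unit is
  orthogonal.\<close>

lemma cayley_skew:
  fixes u x y :: "'a::comm_ring_1 ^ 8"
  assumes "u $ 0 = 0"
  shows "dot (u \<cdot>\<^sub>C x) y = - dot x (u \<cdot>\<^sub>C y)"
  using assms by (simp add: dot_def sum_8 cayley_mult_component algebra_simps)

text \<open>The left alternative law \<open>u (u y) = (u u) y\<close> combined with
  \<open>u u = - dot u u\<close>; this is the defining relation of a Clifford module.\<close>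

lemma cayley_clifford_square:
  fixes u y :: "'a::comm_ring_1 ^ 8"
  assumes "u $ 0 = 0"
  shows "u \<cdot>\<^sub>C (u \<cdot>\<^sub>C y) = (- dot u u) *s y"
  using assms unfolding vec_eq_iff forall_8
  by (simp add: dot_def sum_8 cayley_mult_component algebra_simps)

lemma dot_commute: "dot x y = dot y x"
  by (simp add: dot_def mult.commute)

lemma dot_linear:
  "dot (x + y) z = dot x z + dot y z" "dot x (y + z) = dot x y + dot x z"
  "dot (x - y) z = dot x z - dot y z" "dot x (y - z) = dot x y - dot x z"
  "dot (- x) y = - dot x y" "dot x (- y) = - dot x y"
  "dot (c *s x) y = c * dot x y" "dot x (c *s y) = c * dot x y"
  "dot 0 y = 0" "dot x 0 = 0"
  by (simp_all add: dot_def sum.distrib sum_subtractf sum_negf sum_distrib_left algebra_simps)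

lemma dot_axis: "dot (axis i 1) x = x $ i" "dot x (axis i 1) = x $ i"
  by (simp_all add: dot_def axis_def if_distrib if_distribR sum.delta cong: if_cong)

lemma dot_transpose: "dot (A *v x) y = dot x (transpose A *v y)"
  unfolding dot_def matrix_vector_mult_def transpose_def
  by (simp add: sum_distrib_left sum_distrib_right) (subst sum.swap, simp add: ac_simps)

lemma matrix_vector_axis: "(A *v axis j 1) $ i = (A $ i $ j :: 'a::comm_ring_1)"
  by (simp add: matrix_vector_mult_def axis_def if_distrib if_distribR sum.delta cong: if_cong)

lemma orthogonal_iff_dot:
  fixes g :: "'a::comm_ring_1 ^ 'n ^ 'n"
  shows "transpose g ** g = mat 1 \<longleftrightarrow> (\<forall>x y. dot (g *v x) (g *v y) = dot x y)"
proof
  assume "transpose g ** g = mat 1"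
  then show "\<forall>x y. dot (g *v x) (g *v y) = dot x y"
    by (simp add: dot_transpose matrix_vector_mul_assoc)
next
  assume *: "\<forall>x y. dot (g *v x) (g *v y) = dot x y"
  have "(transpose g ** g) $ i $ j = mat 1 $ i $ j" for i j
  proof -
    have "(transpose g ** g) $ i $ j = dot (g *v axis i 1) (g *v axis j 1)"
      by (simp add: dot_def matrix_matrix_mult_def transpose_def matrix_vector_axis)
    also have "\<dots> = mat 1 $ i $ j"
      by (simp add: * dot_axis) (simp add: axis_def mat_def)
    finally show ?thesis .
  qed
  then show "transpose g ** g = mat 1" by (simp add: vec_eq_iff)
qed

lemma cayley_linear:
  fixes x y z :: "'a::comm_ring_1 ^ 8"
  shows "(x + y) \<cdot>\<^sub>C z = x \<cdot>\<^sub>C z + y \<cdot>\<^sub>C z" "x \<cdot>\<^sub>C (y + z) = x \<cdot>\<^sub>C y + x \<cdot>\<^sub>C z"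
    "(x - y) \<cdot>\<^sub>C z = x \<cdot>\<^sub>C z - y \<cdot>\<^sub>C z" "x \<cdot>\<^sub>C (y - z) = x \<cdot>\<^sub>C y - x \<cdot>\<^sub>C z"
    "(- x) \<cdot>\<^sub>C y = - (x \<cdot>\<^sub>C y)" "x \<cdot>\<^sub>C (- y) = - (x \<cdot>\<^sub>C y)"
    "(c *s x) \<cdot>\<^sub>C y = c *s (x \<cdot>\<^sub>C y)" "x \<cdot>\<^sub>C (c *s y) = c *s (x \<cdot>\<^sub>C y)"
    "0 \<cdot>\<^sub>C y = 0" "x \<cdot>\<^sub>C 0 = 0"
  by (simp_all add: cayley_mult_def vec_eq_iff sum.distrib sum_subtractf sum_negf sum_distrib_left
      algebra_simps)

lemma cayley_unit:
  fixes x :: "'a::comm_ring_1 ^ 8"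
  shows "axis 0 1 \<cdot>\<^sub>C x = x" "x \<cdot>\<^sub>C axis 0 1 = x"
  unfolding vec_eq_iff forall_8 by (simp_all add: cayley_mult_component axis_def)

text \<open>Polarization of \<open>cayley_clifford_square\<close> at \<open>u + v\<close>; left
  multiplications by orthogonal imaginary vectors anticommute.\<close>

lemma cayley_clifford:
  fixes u v y :: "'a::comm_ring_1 ^ 8"
  assumes "u $ 0 = 0" "v $ 0 = 0"
  shows "u \<cdot>\<^sub>C (v \<cdot>\<^sub>C y) = - (v \<cdot>\<^sub>C (u \<cdot>\<^sub>C y)) - (2 * dot u v) *s y"
proof -
  have "(u + v) \<cdot>\<^sub>C ((u + v) \<cdot>\<^sub>C y) = (- dot (u + v) (u + v)) *s y"
    using assms by (intro cayley_clifford_square) simp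
  then show ?thesis
    using assms by (simp add: cayley_linear dot_linear cayley_clifford_square dot_commute[of v u]
      algebra_simps eq_neg_iff_add_eq_0) (simp add: vec_eq_iff algebra_simps)
qed

lemma cayley_imaginary_square:
  fixes u :: "'a::comm_ring_1 ^ 8"
  assumes "u $ 0 = 0"
  shows "u \<cdot>\<^sub>C u = - dot u u *s axis 0 1"
  using cayley_clifford_square[OF assms, of "axis 0 1"] by (simp add: cayley_unit)

definition left_mult :: "'a::comm_ring_1 ^ 8 \<Rightarrow> 'a ^ 8 ^ 8" where
  "left_mult u = (\<chi> k j. \<Sum>i\<in>UNIV. of_int (cayley_coeff i j k) * u $ i)"

lemma left_mult_works: "left_mult u *v x = u \<cdot>\<^sub>C x"
  by (simp add: left_mult_def matrix_vector_mult_def cayley_mult_def vec_eq_iff sum_distrib_right)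
    (subst sum.swap, simp add: ac_simps)

text \<open>For an imaginary unit \<open>u\<close> this is the identity on the span of
  \<open>e\<^sub>0\<close> and \<open>u\<close> and \<open>- 1\<close> on the orthogonal complement.
  The summand 2 at position \<open>(0, 0)\<close> restores the sign at
  \<open>e\<^sub>0\<close>.\<close>

definition half_turn :: "'a::comm_ring_1 ^ 8 \<Rightarrow> 'a ^ 8 ^ 8" where
  "half_turn u = (\<chi> i j. 2 * u $ i * u $ j - (if i = j then 1 else 0)
     + (if i = 0 \<and> j = 0 then 2 else 0))"

lemma half_turn_works:
  "half_turn u *v x = (2 * dot u x) *s u - x + (2 * x $ 0) *s axis 0 1"
proof -
  have "(half_turn u *v x) $ i = ((2 * dot u x) *s u - x + (2 * x $ 0) *s axis 0 1) $ i" for i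
  proof -
    have "(half_turn u *v x) $ i = (\<Sum>j\<in>UNIV. 2 * u $ i * u $ j * x $ j)
        - (\<Sum>j\<in>UNIV. if i = j then x $ j else 0)
        + (\<Sum>j\<in>UNIV. if j = 0 then if i = 0 then 2 * x $ j else 0 else 0)"
      unfolding half_turn_def matrix_vector_mult_def sum.distrib[symmetric] sum_subtractf[symmetric]
      by (auto intro!: sum.cong simp: algebra_simps)
    also have "(\<Sum>j\<in>UNIV. 2 * u $ i * u $ j * x $ j) = 2 * dot u x * u $ i"
      by (simp add: dot_def sum_distrib_left sum_distrib_right ac_simps)
    finally show ?thesis
      by (simp add: axis_def)
  qed
  then show ?thesis by (simp add: vec_eq_iff)
qed

section \<open>Half turns and spin pairs\<close>

declare transpose_matrix_vector [simp del] vector_transpose_matrix [simp del]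

lemma matrix_vector_smult: "A *v (c *s x) = c *s (A *v (x :: 'a::comm_ring_1 ^ 'n))"
  by (simp add: matrix_vector_mult_def vec_eq_iff sum_distrib_left ac_simps)

lemma matrix_vector_uminus: "(- A) *v x = - (A *v (x :: 'a::comm_ring_1 ^ 'n))"
  by (simp add: matrix_vector_mult_def vec_eq_iff sum_negf)

lemma SO7C_iff: "g \<in> SO7C \<longleftrightarrow> det g = 1 \<and> transpose g ** g = mat 1 \<and> g *v axis 0 1 = axis 0 1"
  by (auto simp: SO7C_def SO8C_def)

lemma prod_8: "prod f (UNIV :: 8 set) = f 0 * f 1 * f 2 * f 3 * f 4 * f 5 * f 6 * f 7"
  unfolding UNIV_8 by (simp add: ac_simps)

lemma SO7C_transpose:
  assumes "g \<in> SO7C"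
  shows "transpose g \<in> SO7C" "g ** transpose g = mat 1"
proof -
  show gg: "g ** transpose g = mat 1"
    by (rule matrix_left_right_inverse1) (use assms in \<open>simp add: SO7C_iff\<close>)
  have "transpose g *v (g *v axis 0 1) = axis 0 1"
    unfolding matrix_vector_mul_assoc using assms by (simp add: SO7C_iff)
  moreover have "g *v axis 0 1 = axis 0 1" using assms by (simp add: SO7C_iff)
  ultimately show "transpose g \<in> SO7C"
    using assms gg by (simp add: SO7C_iff)
qed

lemma orthogonal_mult:
  fixes g h :: "'a::comm_ring_1 ^ 'n ^ 'n"
  assumes "transpose g ** g = mat 1" "transpose h ** h = mat 1"
  shows "transpose (g ** h) ** (g ** h) = mat 1"
  using assms by (simp add: orthogonal_iff_dot flip: matrix_vector_mul_assoc)

lemma SO7C_mult: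
  assumes "g \<in> SO7C" "h \<in> SO7C"
  shows "g ** h \<in> SO7C"
  using assms by (simp add: SO7C_iff orthogonal_mult det_mul flip: matrix_vector_mul_assoc)

lemma SO7_mult:
  assumes "g \<in> SO7" "h \<in> SO7"
  shows "g ** h \<in> SO7"
proof -
  have "(g ** h) $ i $ j \<in> \<real>" for i j
    using assms by (auto simp: SO7_def matrix_matrix_mult_def intro!: sum_in_Reals Reals_mult)
  then show ?thesis using assms by (simp add: SO7_def SO7C_mult)
qed

lemma SO7_transpose: "g \<in> SO7 \<Longrightarrow> transpose g \<in> SO7"
  by (simp add: SO7_def SO7C_transpose) (simp add: transpose_def)

text \<open>The coefficient at \<open>e\<^sub>0\<close> is the pairing with
  \<open>e\<^sub>0\<close>, and \<open>g\<close> preserves the form and fixes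
  \<open>e\<^sub>0\<close>. In particular imaginary vectors stay imaginary.\<close>

lemma fix_unit_component:
  fixes g :: "'a::comm_ring_1 ^ 8 ^ 8"
  assumes "transpose g ** g = mat 1" "g *v axis 0 1 = axis 0 1"
  shows "(g *v x) $ 0 = x $ 0"
proof -
  have "dot (g *v x) (g *v axis 0 1) = dot x (axis 0 1)"
    using assms(1)[unfolded orthogonal_iff_dot] by blast
  then show ?thesis by (simp add: assms(2) dot_axis)
qed

lemma half_turn_orthogonal:
  fixes u :: "'a::comm_ring_1 ^ 8"
  assumes "u $ 0 = 0" "dot u u = 1"
  shows "transpose (half_turn u) ** half_turn u = mat 1"
  unfolding orthogonal_iff_dot
proof (intro allI)
  fix x y :: "'a ^ 8"
  show "dot (half_turn u *v x) (half_turn u *v y) = dot x y"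
    unfolding half_turn_works
    by (simp add: dot_linear dot_axis assms dot_commute[of x u] algebra_simps)
qed

lemma half_turn_unit:
  fixes u :: "'a::comm_ring_1 ^ 8"
  assumes "u $ 0 = 0"
  shows "half_turn u *v axis 0 1 = axis 0 1"
  unfolding half_turn_works using assms by (simp add: dot_axis vec_eq_iff)

text \<open>A half turn is built from its axis, the form and \<open>e\<^sub>0\<close> alone, and
  \<open>g\<close> preserves the last two.\<close>

lemma half_turn_conj:
  fixes u :: "'a::comm_ring_1 ^ 8"
  assumes "transpose g ** g = mat 1" "g *v axis 0 1 = axis 0 1"
  shows "g ** half_turn u = half_turn (g *v u) ** g"
  unfolding matrix_eq matrix_vector_mul_assoc[symmetric]
proof
  fix x
  have "dot (g *v u) (g *v x) = dot u x" "(g *v x) $ 0 = x $ 0"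
    using assms fix_unit_component[OF assms] by (auto simp: orthogonal_iff_dot)
  then show "g *v (half_turn u *v x) = half_turn (g *v u) *v (g *v x)"
    by (simp only: half_turn_works matrix_vector_right_distrib
        matrix_vector_mult_diff_distrib matrix_vector_smult assms(2))
qed

text \<open>The axis is the bisector \<open>p + q\<close>, which has to be nonisotropic. Recording
  \<open>n\<close> as a multiple of \<open>p + q\<close> shows later that \<open>n\<close> vanishes
  in every coordinate where \<open>p\<close> and \<open>q\<close> both do.\<close>

lemma half_turn_swap:
  fixes p q :: "complex ^ 8"
  assumes "p $ 0 = 0" "q $ 0 = 0" "dot p p = dot q q" "dot (p + q) (p + q) \<noteq> 0"
  obtains n c where "n $ 0 = 0" "dot n n = 1" "n = c *s (p + q)" "half_turn n *v p = q"
proof -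
  define r where "r = csqrt (dot (p + q) (p + q))"
  have r2: "r * r = dot (p + q) (p + q)" by (simp add: r_def flip: power2_eq_square)
  have r0: "r \<noteq> 0" using r2 assms by auto
  define n where "n = inverse r *s (p + q)"
  have "dot n n = 1" using r0 unfolding n_def dot_linear(7,8) r2[symmetric] by (simp add: field_simps)
  moreover have "n $ 0 = 0" using assms by (simp add: n_def)
  moreover have "half_turn n *v p = q"
  proof -
    have "2 * dot n p * inverse r = 1"
    proof -
      have rr: "r * r = 2 * dot (p + q) p"
        using assms(3) by (simp add: r2 dot_linear dot_commute[of q p])
      have "2 * dot n p * inverse r = 2 * dot (p + q) p * (inverse r * inverse r)"
        unfolding n_def dot_linear(7) by (simp only: ac_simps)
      also have "\<dots> = r * r * (inverse r * inverse r)"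
        using rr by simp
      also have "\<dots> = 1" using r0 by (simp add: field_simps)
      finally show ?thesis .
    qed
    then have "(2 * dot n p) *s n = p + q"
      unfolding n_def by (simp add: vector_smult_assoc)
    then show ?thesis using assms by (simp add: half_turn_works)
  qed
  ultimately show ?thesis using that n_def by blast
qed

lemma half_turn_uminus: "half_turn (- u) = half_turn u"
  by (simp add: half_turn_def vec_eq_iff)

text \<open>Every half turn is conjugate to the one about \<open>e\<^sub>1\<close>, a diagonal
  matrix with six entries \<open>- 1\<close>.\<close>

lemma det_half_turn:
  fixes u :: "complex ^ 8"
  assumes u: "u $ 0 = 0" "dot u u = 1"
  shows "det (half_turn u) = 1"
proof -
  have conj: "det (half_turn (half_turn n *v u)) = det (half_turn u)"
    if "n $ 0 = 0" "dot n n = 1" for n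
  proof -
    have "half_turn n ** half_turn u = half_turn (half_turn n *v u) ** half_turn n"
      using that by (intro half_turn_conj half_turn_orthogonal half_turn_unit)
    then have "det (half_turn n) * det (half_turn u) =
        det (half_turn (half_turn n *v u)) * det (half_turn n)"
      by (metis det_mul)
    moreover have "det (half_turn n) \<noteq> 0"
    proof
      assume "det (half_turn n) = 0"
      moreover have "det (transpose (half_turn n) ** half_turn n) = 1"
        by (simp add: half_turn_orthogonal that)
      ultimately show False by (simp add: det_mul)
    qed
    ultimately show ?thesis by simp
  qed
  have e: "det (half_turn (axis 1 1) :: complex ^ 8 ^ 8) = 1"
    by (subst det_diagonal) (auto simp: half_turn_def axis_def prod_8)
  define e1 :: "complex ^ 8" where "e1 = axis 1 1"
  have e1: "e1 $ 0 = 0" "dot e1 e1 = 1" by (simp_all add: e1_def dot_axis) (simp add: axis_def)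
  \<comment> \<open>By the parallelogram law \<open>u + e1\<close> and \<open>u - e1\<close> are not
    both isotropic. Either target will do, since \<open>e1\<close> and \<open>- e1\<close> define
    the same half turn.\<close>
  have sum4: "dot (u + e1) (u + e1) + dot (u + - e1) (u + - e1) = 4"
    using u e1 by (simp add: dot_linear)
  consider "dot (u + e1) (u + e1) \<noteq> 0" | "dot (u + - e1) (u + - e1) \<noteq> 0"
  proof -
    assume "dot (u + e1) (u + e1) \<noteq> 0 \<Longrightarrow> thesis" "dot (u + - e1) (u + - e1) \<noteq> 0 \<Longrightarrow> thesis"
    then show thesis using sum4 by (metis add.right_neutral zero_neq_numeral)
  qed
  then show ?thesis
  proof cases
    case 1
    have d: "dot u u = dot e1 e1" using u e1 by simp
    obtain n where "n $ 0 = 0" "dot n n = 1" "half_turn n *v u = e1"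
      by (rule half_turn_swap[OF u(1) e1(1) d 1])
    then show ?thesis using conj[of n] e by (simp add: e1_def)
  next
    case 2
    have d: "dot u u = dot (- e1) (- e1)" "(- e1) $ 0 = 0" using u e1 by (simp_all add: dot_linear)
    obtain n where "n $ 0 = 0" "dot n n = 1" "half_turn n *v u = - e1"
      by (rule half_turn_swap[OF u(1) d(2,1) 2])
    then show ?thesis using conj[of n] e by (simp add: e1_def half_turn_uminus)
  qed
qed

lemma half_turn_SO7C: "u $ 0 = 0 \<Longrightarrow> dot u u = 1 \<Longrightarrow> half_turn u \<in> SO7C"
  by (simp add: SO7C_iff det_half_turn half_turn_orthogonal half_turn_unit)

text \<open>The graph of the covering of the rotation group by the spin group: in a product the left
  factor is a vector, moved by \<open>g\<close>, and the right factor is a spinor, moved by the lift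
  \<open>M\<close>.\<close>

definition spin_pair :: "complex ^ 8 ^ 8 \<Rightarrow> complex ^ 8 ^ 8 \<Rightarrow> bool" where
  "spin_pair g M \<longleftrightarrow> g \<in> SO7C \<and> transpose M ** M = mat 1
     \<and> (\<forall>x y. M *v (x \<cdot>\<^sub>C y) = (g *v x) \<cdot>\<^sub>C (M *v y))"

lemma spin_pair_one: "spin_pair (mat 1) (mat 1)"
  by (simp add: spin_pair_def SO7C_iff)

lemma spin_pair_uminus: "spin_pair g M \<Longrightarrow> spin_pair g (- M)"
  by (simp add: spin_pair_def orthogonal_iff_dot matrix_vector_uminus dot_linear cayley_linear)

lemma spin_pair_mult: "spin_pair g M \<Longrightarrow> spin_pair h N \<Longrightarrow> spin_pair (g ** h) (M ** N)"
  by (simp add: spin_pair_def SO7C_mult orthogonal_mult flip: matrix_vector_mul_assoc)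

lemma spin_pair_transpose:
  assumes "spin_pair g M"
  shows "spin_pair (transpose g) (transpose M)"
proof -
  have M: "transpose M ** M = mat 1" using assms by (simp add: spin_pair_def)
  note M = M matrix_left_right_inverse1[OF M]
  have g: "g ** transpose g = mat 1" "transpose g \<in> SO7C"
    using assms by (simp_all add: spin_pair_def SO7C_transpose)
  have "transpose M *v (x \<cdot>\<^sub>C y) = (transpose g *v x) \<cdot>\<^sub>C (transpose M *v y)" for x y
  proof -
    have "x \<cdot>\<^sub>C y = (g *v (transpose g *v x)) \<cdot>\<^sub>C (M *v (transpose M *v y))"
      by (simp add: matrix_vector_mul_assoc M g)
    also have "\<dots> = M *v ((transpose g *v x) \<cdot>\<^sub>C (transpose M *v y))"
      using assms by (simp add: spin_pair_def)
    finally show ?thesis by (simp add: matrix_vector_mul_assoc M)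
  qed
  then show ?thesis using M g by (simp add: spin_pair_def)
qed

text \<open>For imaginary \<open>x\<close> the intertwining rule is the Clifford relation; the part
  of \<open>x\<close> along \<open>e\<^sub>0\<close> is fixed by the half turn and is split off
  first.\<close>

lemma spin_pair_half_turn:
  assumes u: "u $ 0 = 0" "dot u u = 1"
  shows "spin_pair (half_turn u) (left_mult u)"
proof -
  have "dot (u \<cdot>\<^sub>C x) (u \<cdot>\<^sub>C y) = dot x y" for x y
    using u by (simp add: cayley_skew cayley_clifford_square dot_linear)
  then have "transpose (left_mult u) ** left_mult u = mat 1"
    by (simp add: orthogonal_iff_dot left_mult_works)
  moreover have "u \<cdot>\<^sub>C (x \<cdot>\<^sub>C y) = (half_turn u *v x) \<cdot>\<^sub>C (u \<cdot>\<^sub>C y)" for x y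
  proof -
    define v where "v = x - (x $ 0) *s axis 0 1"
    have v: "v $ 0 = 0" "x = v + (x $ 0) *s axis 0 1" by (simp_all add: v_def)
    \<comment> \<open>Rewriting \<open>y\<close> as \<open>- u (u y)\<close> turns the scalar term
      of the Clifford relation into a multiple of \<open>u\<close> acting on
      \<open>u y\<close>.\<close>
    have y: "u \<cdot>\<^sub>C (u \<cdot>\<^sub>C y) = - y" using u by (simp add: cayley_clifford_square)
    have h: "half_turn u *v x = (2 * dot u v) *s u - v + (x $ 0) *s axis 0 1"
      unfolding half_turn_works using u
      by (simp add: v_def dot_linear dot_axis algebra_simps) (simp add: vec_eq_iff algebra_simps)
    have "u \<cdot>\<^sub>C (x \<cdot>\<^sub>C y) = u \<cdot>\<^sub>C (v \<cdot>\<^sub>C y) + (x $ 0) *s (u \<cdot>\<^sub>C y)"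
      by (subst v(2)) (simp add: cayley_linear cayley_unit)
    also have "\<dots> = (half_turn u *v x) \<cdot>\<^sub>C (u \<cdot>\<^sub>C y)"
      unfolding h cayley_clifford[OF u(1) v(1)]
      by (simp add: cayley_linear cayley_unit y)
    finally show ?thesis .
  qed
  ultimately show ?thesis
    using half_turn_SO7C[OF u] by (simp add: spin_pair_def left_mult_works)
qed

text \<open>Putting \<open>y = e\<^sub>0\<close> in the intertwining rule gives
  \<open>M x = g x\<close>, and then the rule itself says that \<open>g\<close> is
  multiplicative.\<close>

lemma spin_pair_G2C:
  assumes "spin_pair g M" "M *v axis 0 1 = axis 0 1"
  shows "g \<in> G2C"
proof -
  have "M *v x = g *v x" for x
  proof -
    have "M *v (x \<cdot>\<^sub>C axis 0 1) = (g *v x) \<cdot>\<^sub>C (M *v axis 0 1)"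
      using assms(1) by (simp add: spin_pair_def)
    then show ?thesis by (simp add: assms(2) cayley_unit)
  qed
  then show ?thesis
    using assms by (simp add: G2C_def spin_pair_def SO7C_def)
qed

lemma axis_component_8:
  "axis 0 (1::'a::comm_ring_1) $ (0::8) = 1" "i \<noteq> j \<Longrightarrow> axis j (1::'a) $ (i::8) = 0" "axis i (1::'a) $ i = 1"
  by (simp_all add: axis_def)

text \<open>Seven equal signs on the diagonal have product \<open>\<epsilon>\<close>, so determinant
  1 excludes \<open>\<epsilon> = - 1\<close>.\<close>

lemma sign_block_SO7C:
  fixes \<epsilon> :: complex
  assumes g: "g \<in> SO7C" and \<epsilon>: "\<epsilon> = 1 \<or> \<epsilon> = - 1"
    and ax: "\<And>i. i \<noteq> 0 \<Longrightarrow> g *v axis i 1 = \<epsilon> *s axis i 1"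
  shows "g = mat 1"
proof -
  have entries: "g $ i $ j = (if i = j then if j = 0 then 1 else \<epsilon> else 0)" for i j
  proof (cases "j = 0")
    case True
    have "g *v axis 0 1 = axis 0 1" using g by (simp add: SO7C_iff)
    then show ?thesis using matrix_vector_axis[of g j i] True by (auto simp: axis_def split: if_splits)
  next
    case False
    then show ?thesis using matrix_vector_axis[of g j i] ax[of j]
      by (auto simp: axis_def split: if_splits)
  qed
  have "det g = \<epsilon> ^ 7"
    by (subst det_diagonal) (simp_all add: entries prod_8 power_numeral_reduce)
  then have "\<epsilon> = 1" using g \<epsilon> by (auto simp: SO7C_iff)
  then show ?thesis by (simp add: vec_eq_iff mat_def entries)
qed

text \<open>
  As in the theorem of Cartan and Dieudonne, but a half turn negates the complement of its axis,
  so the basis vectors that have been dealt with carry the sign \<open>\<epsilon>\<close> instead of being fixed.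
\<close>

lemma exists_spin_pair_aux:
  assumes "finite A" "g \<in> SO7C" "\<epsilon> = 1 \<or> \<epsilon> = - 1"
    "\<And>i. i \<noteq> 0 \<Longrightarrow> i \<notin> A \<Longrightarrow> g *v axis i 1 = \<epsilon> *s axis i 1"
  shows "\<exists>M. spin_pair g M"
  using assms
proof (induction A arbitrary: g \<epsilon> rule: finite_induct)
  case empty
  then have "g = mat 1" by (intro sign_block_SO7C) auto
  then show ?case using spin_pair_one by blast
next
  case (insert a A)
  note g = \<open>g \<in> SO7C\<close>
  \<comment> \<open>Lifts compose and a half turn has a lift, so a half turn may be multiplied to
    \<open>h\<close> and removed again.\<close>
  have reduce: "\<exists>M. spin_pair h M"
    if n: "n $ 0 = 0" "dot n n = 1" "\<exists>M. spin_pair (half_turn n ** h) M" for n h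
  proof -
    obtain M where "spin_pair (half_turn n ** h) M" using n by blast
    from spin_pair_mult[OF spin_pair_transpose[OF spin_pair_half_turn[OF n(1,2)]] this]
    show ?thesis
      by (auto simp: matrix_mul_assoc half_turn_orthogonal[OF n(1,2)])
  qed
  show ?case
  proof (cases "a = 0")
    case True
    then show ?thesis using insert by (metis insertE)
  next
    case False
    define e where "e = (axis a 1 :: complex ^ 8)"
    define v where "v = g *v e"
    have e: "e $ 0 = 0" "dot e e = 1"
      using False by (simp_all add: e_def dot_axis axis_component_8)
    have gdot: "dot (g *v x) (g *v y) = dot x y" for x y
      using g by (simp add: SO7C_iff orthogonal_iff_dot)
    have v: "v $ 0 = 0" "dot v v = 1"
      using g e by (simp_all add: v_def gdot) (simp add: SO7C_iff fix_unit_component)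
    have eps: "\<epsilon> * \<epsilon> = 1" using insert.prems by auto
    \<comment> \<open>The finished axes are eigenvectors of \<open>g\<close>, so \<open>v\<close> is
      orthogonal to them; the axes of the half turns used below then have no component
      there.\<close>
    have vi: "v $ i = 0" if "i \<noteq> 0" "i \<notin> insert a A" for i
    proof -
      have "dot v (\<epsilon> *s axis i 1) = dot e (axis i 1)"
        unfolding v_def insert.prems(3)[OF that, symmetric] by (rule gdot)
      then show ?thesis
        using that insert.prems(2) by (auto simp: dot_linear dot_axis e_def axis_component_8)
    qed
    have ei: "e $ i = 0" if "i \<notin> insert a A" for i
      using that by (auto simp: e_def axis_component_8)
    have turn: "half_turn n *v axis i 1 = - axis i 1" if "i \<noteq> 0" "n $ i = 0" for i n
      using that by (simp add: half_turn_works dot_axis axis_component_8)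
    \<comment> \<open>The two squared lengths add up to 4, hence one of the bisectors is
      nonisotropic.\<close>
    consider "dot (v + - (\<epsilon> *s e)) (v + - (\<epsilon> *s e)) \<noteq> 0" | "dot (v + \<epsilon> *s e) (v + \<epsilon> *s e) \<noteq> 0"
    proof -
      assume *: "dot (v + - (\<epsilon> *s e)) (v + - (\<epsilon> *s e)) \<noteq> 0 \<Longrightarrow> thesis"
        "dot (v + \<epsilon> *s e) (v + \<epsilon> *s e) \<noteq> 0 \<Longrightarrow> thesis"
      have "dot (v + - (\<epsilon> *s e)) (v + - (\<epsilon> *s e)) + dot (v + \<epsilon> *s e) (v + \<epsilon> *s e) = 4"
        using v e eps by (simp add: dot_linear algebra_simps)
      then show thesis using * by (metis add.right_neutral zero_neq_numeral)
    qed
    then show ?thesis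
    proof cases
      case 1
      have q: "dot v v = dot (- (\<epsilon> *s e)) (- (\<epsilon> *s e))" "(- (\<epsilon> *s e)) $ 0 = 0"
        using v e eps by (simp_all add: dot_linear)
      obtain n c where n: "n $ 0 = 0" "dot n n = 1" "n = c *s (v + - (\<epsilon> *s e))"
          "half_turn n *v v = - (\<epsilon> *s e)"
        by (rule half_turn_swap[OF v(1) q(2,1) 1])
      \<comment> \<open>The half turn sends \<open>v\<close> to \<open>- \<epsilon> e\<close> and
        negates the finished axes, so all of them now carry the sign
        \<open>- \<epsilon>\<close>.\<close>
      have "(half_turn n ** g) *v axis i 1 = (- \<epsilon>) *s axis i 1" if "i \<noteq> 0" "i \<notin> A" for i
      proof (cases "i = a")
        case True
        then show ?thesis using n(4)
          by (simp add: e_def v_def vector_smult_lneg flip: matrix_vector_mul_assoc)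
      next
        case False
        then have "i \<notin> insert a A" using that by simp
        moreover from this have "n $ i = 0" using n(3) vi ei that by simp
        ultimately show ?thesis using insert.prems(3)[of i] that
          by (simp add: matrix_vector_smult turn vector_smult_lneg flip: matrix_vector_mul_assoc)
      qed
      moreover have "half_turn n ** g \<in> SO7C" using n g by (simp add: SO7C_mult half_turn_SO7C)
      moreover have "- \<epsilon> = 1 \<or> - \<epsilon> = - 1" using insert.prems(2) by auto
      ultimately have "\<exists>M. spin_pair (half_turn n ** g) M"
        using insert.IH[of "half_turn n ** g" "- \<epsilon>"] by blast
      then show ?thesis by (rule reduce[OF n(1,2)])
    next
      case 2
      have q: "dot v v = dot (\<epsilon> *s e) (\<epsilon> *s e)" "(\<epsilon> *s e) $ 0 = 0"
        using v e eps by (simp_all add: dot_linear)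
      obtain n c where n: "n $ 0 = 0" "dot n n = 1" "n = c *s (v + \<epsilon> *s e)"
          "half_turn n *v v = \<epsilon> *s e"
        by (rule half_turn_swap[OF v(1) q(2,1) 2])
      \<comment> \<open>The first half turn gives the new axis the sign \<open>\<epsilon>\<close>
        but the finished ones \<open>- \<epsilon>\<close>. A second half turn, about
        \<open>e\<close>, fixes \<open>e\<close> and negates the finished axes back.\<close>
      have he: "half_turn e *v e = e" using e by (simp add: half_turn_works vec_eq_iff)
      have "(half_turn e ** (half_turn n ** g)) *v axis i 1 = \<epsilon> *s axis i 1" if "i \<noteq> 0" "i \<notin> A" for i
      proof (cases "i = a")
        case True
        then show ?thesis using n(4) he
          by (simp add: e_def v_def matrix_vector_smult flip: matrix_vector_mul_assoc)
      next
        case False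
        then have i: "i \<notin> insert a A" using that by simp
        then have "n $ i = 0" using n(3) vi ei that by simp
        then show ?thesis using insert.prems(3)[OF that(1) i] that ei[OF i]
          by (simp add: matrix_vector_smult turn matrix_vector_uminus vec.neg flip: matrix_vector_mul_assoc)
      qed
      moreover have "half_turn e ** (half_turn n ** g) \<in> SO7C"
        using n g e by (simp add: SO7C_mult half_turn_SO7C)
      ultimately have "\<exists>M. spin_pair (half_turn e ** (half_turn n ** g)) M"
        using insert.IH[of "half_turn e ** (half_turn n ** g)" \<epsilon>] insert.prems(2) by blast
      then show ?thesis by (rule reduce[OF n(1,2) reduce[OF e]])
    qed
  qed
qed

text \<open>With \<open>A = UNIV\<close> no axis is finished and the condition on the axes is
  vacuous.\<close>

lemma exists_spin_pair: "g \<in> SO7C \<Longrightarrow> \<exists>M. spin_pair g M"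
  using exists_spin_pair_aux[of UNIV g 1] by simp

section \<open>Real spinors\<close>

definition complexify :: "real ^ 8 \<Rightarrow> complex ^ 8" where
  "complexify x = (\<chi> i. complex_of_real (x $ i))"

lemma complexify_simps:
  "complexify x $ i = complex_of_real (x $ i)"
  "complexify (x \<cdot>\<^sub>C y) = complexify x \<cdot>\<^sub>C complexify y"
  "dot (complexify x) (complexify y) = complex_of_real (dot x y)"
  "complexify (c *s x) = complex_of_real c *s complexify x"
  "complexify (axis i 1) = axis i 1"
  "complexify (x + y) = complexify x + complexify y"
  by (simp_all add: complexify_def cayley_mult_def dot_def vec_eq_iff axis_def)

lemma complexify_inject: "complexify x = complexify y \<longleftrightarrow> x = y"
  by (simp add: complexify_def vec_eq_iff)

lemma dot_eq_inner: "dot x y = x \<bullet> (y :: real ^ 'n)"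
  by (simp add: dot_def inner_vec_def)

lemma dot_normalize:
  fixes x :: "real ^ 'n"
  assumes "x \<noteq> 0"
  shows "dot (inverse (norm x) *s x) (inverse (norm x) *s x) = 1"
proof -
  have "dot x x = norm x * norm x" by (simp add: dot_eq_inner dot_square_norm power2_eq_square)
  then show ?thesis using assms by (simp add: dot_linear(7,8) field_simps)
qed

text \<open>The action of the compact spin group on \<open>real ^ 8\<close>. A map is used instead
  of a matrix so that nested left multiplications can be written directly.\<close>

definition real_spin :: "(real ^ 8 \<Rightarrow> real ^ 8) \<Rightarrow> bool" where
  "real_spin T \<longleftrightarrow>
    (\<exists>k N. k \<in> SO7 \<and> spin_pair k N \<and> (\<forall>y. N *v complexify y = complexify (T y)))"

lemma real_spin_id: "real_spin (\<lambda>x. x)"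
proof -
  have "mat 1 \<in> SO7" by (simp add: SO7_def SO7C_iff) (simp add: mat_def)
  then show ?thesis using spin_pair_one by (fastforce simp: real_spin_def)
qed

lemma real_spin_compose:
  assumes "real_spin S" "real_spin T"
  shows "real_spin (\<lambda>x. S (T x))"
proof -
  obtain k M where 1: "k \<in> SO7" "spin_pair k M" "\<And>y. M *v complexify y = complexify (S y)"
    using assms unfolding real_spin_def by blast
  obtain l N where 2: "l \<in> SO7" "spin_pair l N" "\<And>y. N *v complexify y = complexify (T y)"
    using assms unfolding real_spin_def by blast
  have "(M ** N) *v complexify y = complexify (S (T y))" for y
    by (simp add: 1 2 flip: matrix_vector_mul_assoc)
  with SO7_mult[OF 1(1) 2(1)] spin_pair_mult[OF 1(2) 2(2)] show ?thesis
    unfolding real_spin_def by blast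
qed

lemma real_spin_left_mult:
  assumes "u $ 0 = 0" "dot u u = 1"
  shows "real_spin (\<lambda>x. u \<cdot>\<^sub>C x)"
proof -
  have u: "complexify u $ 0 = 0" "dot (complexify u) (complexify u) = 1"
    using assms by (simp_all add: complexify_simps)
  have "half_turn (complexify u) \<in> SO7"
    using half_turn_SO7C[OF u] by (simp add: SO7_def) (simp add: half_turn_def complexify_simps)
  moreover have "left_mult (complexify u) *v complexify y = complexify (u \<cdot>\<^sub>C y)" for y
    by (simp add: left_mult_works complexify_simps)
  ultimately show ?thesis
    unfolding real_spin_def using spin_pair_half_turn[OF u] by blast
qed

lemma real_spin_linear:
  assumes "real_spin T"
  shows "dot (T x) (T y) = dot x y" "T (c *s x) = c *s T x"
proof -
  obtain k N where N: "spin_pair k N" "\<And>y. N *v complexify y = complexify (T y)"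
    using assms unfolding real_spin_def by blast
  have "dot (N *v complexify x) (N *v complexify y) = dot (complexify x) (complexify y)"
    using N(1) by (simp add: spin_pair_def orthogonal_iff_dot)
  then show "dot (T x) (T y) = dot x y"
    by (simp only: N(2) complexify_simps of_real_eq_iff)
  have "complexify (T (c *s x)) = complexify (c *s T x)"
    by (simp only: N(2)[symmetric] complexify_simps matrix_vector_smult)
  then show "T (c *s x) = c *s T x" by (simp only: complexify_inject)
qed

section \<open>Transitivity of the real lifts on pairs of orthogonal directions\<close>

lemma exists_unit_perp:
  fixes S :: "(real ^ 8) set"
  assumes "finite S" "card S < 8"
  obtains v where "dot v v = 1" "\<And>s. s \<in> S \<Longrightarrow> dot v s = 0"
proof -
  have "dim S < DIM(real ^ 8)"
    using dim_le_card'[OF assms(1)] assms(2) by simp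
  from orthogonal_to_subspace_exists[OF this] obtain x
    where x: "x \<noteq> 0" "\<And>y. y \<in> span S \<Longrightarrow> orthogonal x y" by blast
  show thesis
  proof
    show "dot (inverse (norm x) *s x) (inverse (norm x) *s x) = 1"
      by (rule dot_normalize[OF x(1)])
    show "dot (inverse (norm x) *s x) s = 0" if "s \<in> S" for s
      using x(2)[of s] that by (simp add: dot_linear(7) orthogonal_def span_base flip: dot_eq_inner)
  qed
qed

text \<open>For an imaginary unit \<open>v\<close> orthogonal to \<open>x\<close>, the product
  \<open>w = v x\<close> is again an imaginary unit, because its pairing with
  \<open>e\<^sub>0\<close> is \<open>- dot x v\<close>. Multiplying \<open>w\<close> by
  \<open>- w\<close> then gives \<open>e\<^sub>0\<close>.\<close>

lemma real_spin_to_unit: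
  assumes "dot x x = 1"
  obtains T where "real_spin T" "T x = axis 0 1"
proof -
  have "card {axis 0 1, x} < 8" by (simp add: card_insert_if)
  then obtain v where v: "dot v v = 1" "\<And>s. s \<in> {axis 0 1, x} \<Longrightarrow> dot v s = 0"
    using exists_unit_perp[of "{axis 0 1, x}"] by blast
  define w where "w = v \<cdot>\<^sub>C x"
  have v0: "v $ 0 = 0" using v(2)[of "axis 0 1"] by (simp add: dot_axis)
  have "w $ 0 = dot w (axis 0 1)" by (simp add: dot_axis)
  also have "\<dots> = 0"
    using v v0 by (simp add: w_def cayley_skew cayley_unit dot_commute[of x v])
  finally have w0: "w $ 0 = 0" .
  have w1: "dot w w = 1"
    using v v0 assms by (simp add: w_def cayley_skew cayley_clifford_square dot_linear)
  have "real_spin (\<lambda>y. (- w) \<cdot>\<^sub>C (v \<cdot>\<^sub>C y))"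
    using w0 w1 v v0
    by (intro real_spin_compose[OF real_spin_left_mult real_spin_left_mult]) (simp_all add: dot_linear)
  moreover have "(- w) \<cdot>\<^sub>C (v \<cdot>\<^sub>C x) = axis 0 1"
    using w0 w1 by (simp flip: w_def add: cayley_linear cayley_imaginary_square)
  ultimately show thesis using that by blast
qed

text \<open>
  For orthonormal imaginary units \<open>p\<close> and \<open>u\<close>, the product \<open>- L\<^bsub>pu\<^esub> L\<^bsub>p\<^esub> L\<^bsub>u\<^esub>\<close> of left
  multiplications is the automorphism that fixes the quaternion algebra generated by \<open>p\<close> and
  \<open>u\<close> and changes the sign on its orthogonal complement.
\<close>

lemma real_spin_quaternion_involution:
  assumes p: "p $ 0 = 0" "dot p p = 1" and u: "u $ 0 = 0" "dot u u = 1" and "dot u p = 0"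
  obtains T where "real_spin T" "T (axis 0 1) = axis 0 1" "T p = p"
    "\<And>d. d $ 0 = 0 \<Longrightarrow> dot u d = 0 \<Longrightarrow> dot p d = 0 \<Longrightarrow> dot (p \<cdot>\<^sub>C u) d = 0 \<Longrightarrow> T d = - d"
    "\<And>x y. T (x + y) = T x + T y"
proof -
  define q where "q = p \<cdot>\<^sub>C u"
  have pu: "dot p u = 0" using assms by (simp add: dot_commute)
  have "q $ 0 = dot q (axis 0 1)" by (simp add: dot_axis)
  also have "\<dots> = 0" using p pu by (simp add: q_def cayley_skew cayley_unit dot_commute)
  finally have q0: "q $ 0 = 0" .
  have q1: "dot q q = 1"
    using p u by (simp add: q_def cayley_skew cayley_clifford_square dot_linear)
  have anti: "x \<cdot>\<^sub>C (y \<cdot>\<^sub>C z) = - (y \<cdot>\<^sub>C (x \<cdot>\<^sub>C z))" if "x $ 0 = 0" "y $ 0 = 0" "dot x y = 0"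
    for x y z :: "real ^ 8"
    using cayley_clifford[of x y z] that by simp
  have anti1: "x \<cdot>\<^sub>C y = - (y \<cdot>\<^sub>C x)" if "x $ 0 = 0" "y $ 0 = 0" "dot x y = 0" for x y :: "real ^ 8"
    using anti[OF that, of "axis 0 1"] by (simp add: cayley_unit)
  define T where "T = (\<lambda>x. (- q) \<cdot>\<^sub>C (p \<cdot>\<^sub>C (u \<cdot>\<^sub>C x)))"
  have "real_spin T"
    unfolding T_def using p u q0 q1
    by (intro real_spin_compose[OF real_spin_left_mult
          real_spin_compose[OF real_spin_left_mult real_spin_left_mult]]) (simp_all add: dot_linear)
  moreover have "T (axis 0 1) = axis 0 1"
    unfolding T_def using q0 q1
    by (simp flip: q_def add: cayley_linear cayley_unit cayley_imaginary_square)
  moreover have "T p = p"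
  proof -
    have "dot q u = - dot u q" using p by (simp add: q_def cayley_skew)
    then have qu: "dot q u = 0" by (simp add: dot_commute[of u q])
    have "p \<cdot>\<^sub>C (u \<cdot>\<^sub>C p) = u"
      using anti1[OF u(1) p(1) assms(5)] p by (simp add: cayley_linear cayley_clifford_square)
    then have "T p = - (q \<cdot>\<^sub>C u)" by (simp add: T_def cayley_linear)
    also have "\<dots> = u \<cdot>\<^sub>C (p \<cdot>\<^sub>C u)" using anti1[OF q0 u(1) qu] by (simp add: q_def)
    also have "\<dots> = - (p \<cdot>\<^sub>C (u \<cdot>\<^sub>C u))" by (rule anti[OF u(1) p(1) assms(5)])
    also have "\<dots> = p" using u by (simp add: cayley_imaginary_square cayley_linear cayley_unit)
    finally show ?thesis .
  qed
  moreover have "T d = - d"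
    if d: "d $ 0 = 0" "dot u d = 0" "dot p d = 0" "dot (p \<cdot>\<^sub>C u) d = 0" for d
  proof -
    \<comment> \<open>As \<open>d\<close> is orthogonal to \<open>u\<close>, \<open>p\<close> and
      \<open>q\<close>, it can be moved past each of them with a sign; this yields
      \<open>p (u d) = - (q d)\<close>, hence \<open>T d = q (q d) = - d\<close>.\<close>
    have "p \<cdot>\<^sub>C (u \<cdot>\<^sub>C d) = - (p \<cdot>\<^sub>C (d \<cdot>\<^sub>C u))"
      using anti1[of u d] d u by (simp add: cayley_linear)
    also have "\<dots> = d \<cdot>\<^sub>C q" using anti[of p d u] d p by (simp add: q_def)
    also have "\<dots> = - (q \<cdot>\<^sub>C d)" using anti1[of d q] d q0 by (simp add: q_def dot_commute)
    finally show ?thesis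
      unfolding T_def using q0 q1 by (simp add: cayley_linear cayley_clifford_square)
  qed
  moreover have "T (x + y) = T x + T y" for x y
    by (simp add: T_def cayley_linear)
  ultimately show thesis using that by blast
qed

text \<open>Split \<open>w\<close> into a multiple of the bisector \<open>p\<close> of
  \<open>w\<close> and \<open>e\<^sub>1\<close> and half of the difference \<open>d\<close>. An
  involution that fixes \<open>p\<close> and negates \<open>d\<close> carries \<open>w\<close> to
  \<open>e\<^sub>1\<close>.\<close>

lemma real_spin_unit_stabilizer:
  assumes w: "w $ 0 = 0" "dot w w = 1"
  obtains T \<sigma> where "real_spin T" "T (axis 0 1) = axis 0 1" "T w = \<sigma> *s axis 1 1"
\<comment> \<open>Here the bisector vanishes; the identity works with \<open>\<sigma> = - 1\<close>,
  while the other case gives \<open>\<sigma> = 1\<close>.\<close>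
proof (cases "w = - axis 1 1")
  case True
  then show ?thesis using that[OF real_spin_id, of "-1"] by (simp add: vec_eq_iff)
next
  case False
  define e1 :: "real ^ 8" where "e1 = axis 1 1"
  have e1: "e1 $ 0 = 0" "dot e1 e1 = 1" by (simp_all add: e1_def dot_axis) (simp add: axis_def)
  define r where "r = norm (w + e1)"
  have r: "r \<noteq> 0" "r * r = dot (w + e1) (w + e1)"
    using False by (auto simp: r_def e1_def eq_neg_iff_add_eq_0 dot_eq_inner dot_square_norm power2_eq_square)
  define p where "p = inverse r *s (w + e1)"
  define d where "d = w - e1"
  have p: "p $ 0 = 0" "dot p p = 1"
  proof -
    show "p $ 0 = 0" using w e1 by (simp add: p_def)
    show "dot p p = 1"
      using r(1) unfolding p_def dot_linear(7,8) r(2)[symmetric] by (simp add: field_simps)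
  qed
  have d: "d $ 0 = 0" "dot p d = 0"
    using w e1 by (simp_all add: d_def p_def dot_linear dot_commute[of e1 w])
  \<comment> \<open>Orthogonality of \<open>u\<close> to \<open>p d\<close> makes \<open>p u\<close>
    orthogonal to \<open>d\<close> by skewness, so \<open>d\<close> is orthogonal to the quaternion
    algebra of \<open>p\<close> and \<open>u\<close>.\<close>
  have "card {axis 0 1, p, d, p \<cdot>\<^sub>C d} < 8"
    by (simp add: card_insert_if)
  then obtain u where u: "dot u u = 1"
    "\<And>s. s \<in> {axis 0 1, p, d, p \<cdot>\<^sub>C d} \<Longrightarrow> dot u s = 0"
    using exists_unit_perp[of "{axis 0 1, p, d, p \<cdot>\<^sub>C d}"] by blast
  have u0: "u $ 0 = 0" using u(2)[of "axis 0 1"] by (simp add: dot_axis)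
  have "dot (p \<cdot>\<^sub>C u) d = 0" using p u by (simp add: cayley_skew)
  obtain T where T: "real_spin T" "T (axis 0 1) = axis 0 1" "T p = p"
      "\<And>d. d $ 0 = 0 \<Longrightarrow> dot u d = 0 \<Longrightarrow> dot p d = 0 \<Longrightarrow> dot (p \<cdot>\<^sub>C u) d = 0 \<Longrightarrow> T d = - d"
      "\<And>x y. T (x + y) = T x + T y"
    using real_spin_quaternion_involution[OF p u0 u(1)] u(2) by blast
  have w_eq: "w = (r / 2) *s p + (1 / 2) *s d"
    using r(1) by (simp add: p_def d_def vec_eq_iff field_simps)
  have "T w = (r / 2) *s T p + (1 / 2) *s T d"
    by (subst w_eq) (simp only: T(5) real_spin_linear(2)[OF T(1)])
  also have "\<dots> = 1 *s e1"
    using T(3) T(4)[OF d(1) _ d(2) \<open>dot (p \<cdot>\<^sub>C u) d = 0\<close>] u(2)[of d] r(1)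
    by (simp add: p_def d_def vec_eq_iff field_simps)
  finally show ?thesis using that[OF T(1,2)] unfolding e1_def by blast
qed

text \<open>First the direction of \<open>x\<close> is moved to \<open>e\<^sub>0\<close>.
  Orthogonality makes the image of \<open>y\<close> imaginary, so a second map fixing
  \<open>e\<^sub>0\<close> can move it into the line of \<open>e\<^sub>1\<close>.\<close>

lemma real_spin_transitive:
  assumes "dot x y = 0" "x \<noteq> 0"
  obtains T b where "real_spin T" "T x = norm x *s axis 0 1" "T y = b *s axis 1 1"
proof -
  obtain T where T: "real_spin T" "T (inverse (norm x) *s x) = axis 0 1"
    by (rule real_spin_to_unit[OF dot_normalize[OF assms(2)]])
  have "x = norm x *s (inverse (norm x) *s x)" using assms(2) by simp
  then have "T x = T (norm x *s (inverse (norm x) *s x))" by (rule arg_cong)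
  also have "\<dots> = norm x *s T (inverse (norm x) *s x)" by (rule real_spin_linear(2)[OF T(1)])
  also have "\<dots> = norm x *s axis 0 1" by (simp only: T(2))
  finally have Tx: "T x = norm x *s axis 0 1" .
  have "norm x * (T y $ 0) = dot (T x) (T y)"
    by (simp add: Tx dot_linear dot_axis)
  also have "\<dots> = 0" using assms real_spin_linear(1)[OF T(1)] by simp
  finally have Ty: "T y $ 0 = 0" using assms(2) by simp
  show thesis
  proof (cases "T y = 0")
    case True
    then show ?thesis using that[OF T(1) Tx, of 0] by simp
  next
    case False
    define w where "w = inverse (norm (T y)) *s T y"
    have w: "w $ 0 = 0" "dot w w = 1"
      using Ty dot_normalize[OF False] by (simp_all add: w_def)
    obtain S \<sigma> where S: "real_spin S" "S (axis 0 1) = axis 0 1" "S w = \<sigma> *s axis 1 1"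
      using real_spin_unit_stabilizer[OF w] by blast
    have "T y = norm (T y) *s w" using False by (simp add: w_def)
    then have "S (T y) = S (norm (T y) *s w)" by (rule arg_cong)
    also have "\<dots> = (norm (T y) * \<sigma>) *s axis 1 1"
      by (simp only: real_spin_linear(2)[OF S(1)] S(3) vector_smult_assoc)
    finally have "S (T y) = (norm (T y) * \<sigma>) *s axis 1 1" .
    moreover have "S (T x) = norm x *s axis 0 1"
      by (simp only: Tx real_spin_linear(2)[OF S(1)] S(2))
    ultimately show ?thesis
      using that[OF real_spin_compose[OF S(1) T(1)]] by blast
  qed
qed

section \<open>The rotations in the planes of the coordinate pairs 23, 45 and 67\<close>

lemma cscale_component: "cscale c A $ i $ j = c * A $ i $ j"
  by (simp add: cscale_def)

lemma cscale_mult: "cscale c A ** B = cscale c (A ** B)" "A ** cscale c B = cscale c (A ** B)"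
  by (simp_all add: vec_eq_iff cscale_component matrix_matrix_mult_def sum_distrib_left ac_simps)

lemma cscale_scaleR: "r *\<^sub>R cscale c A = cscale (r *\<^sub>R c) A"
  by (simp add: vec_eq_iff cscale_component)

lemma matrix_mult_scaleR: "A ** (r *\<^sub>R B) = r *\<^sub>R (A ** (B :: complex ^ 'n ^ 'm))"
  by (simp add: vec_eq_iff matrix_matrix_mult_def scaleR_sum_right)

lemma matrix_mult_add_left: "(A + B) ** C = A ** C + B ** (C :: 'a::semiring_1 ^ 'n ^ 'm)"
  by (simp add: vec_eq_iff matrix_matrix_mult_def sum.distrib distrib_right)

lemma matrix_sumsI:
  fixes f :: "nat \<Rightarrow> complex ^ 'n ^ 'm"
  assumes "\<And>i j. (\<lambda>k. f k $ i $ j) sums (s $ i $ j)"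
  shows "f sums s"
  using assms unfolding sums_def by (intro vec_tendstoI) simp

text \<open>A complex structure on the last six coordinates, zero on the first two;
  \<open>diag_delta t\<close> is \<open>\<i> t\<close> times it.\<close>

definition J\<^sub>0 :: "complex ^ 8 ^ 8" where
  "J\<^sub>0 = (\<chi> i j. if (i, j) \<in> {(2,3), (4,5), (6,7)} then - 1
     else if (i, j) \<in> {(3,2), (5,4), (7,6)} then 1 else 0)"

definition block_diag :: "complex \<Rightarrow> complex \<Rightarrow> complex ^ 8 ^ 8" where
  "block_diag a b = (\<chi> i j. if i = j then if i = 0 \<or> i = 1 then a else b else 0)"

text \<open>The closed form of the exponential of \<open>z\<close> times \<open>J\<^sub>0\<close>:
  real rotations for real \<open>z\<close>, the elements of \<open>A\<^sub>0\<close> for imaginary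
  \<open>z\<close>.\<close>

definition rot :: "complex \<Rightarrow> complex ^ 8 ^ 8" where
  "rot z = block_diag 1 (cos z) + cscale (sin z) J\<^sub>0"

lemma diag_delta_eq: "diag_delta t = cscale (\<i> * complex_of_real t) J\<^sub>0"
  by (simp add: diag_delta_def J\<^sub>0_def vec_eq_iff cscale_component)

lemma J\<^sub>0_mult:
  "J\<^sub>0 ** J\<^sub>0 = block_diag 0 (- 1)" "J\<^sub>0 ** block_diag a b = cscale b J\<^sub>0"
  "block_diag a b ** J\<^sub>0 = cscale b J\<^sub>0"
  "block_diag a b ** block_diag c d = block_diag (a * c) (b * d)"
  unfolding vec_eq_iff forall_8
  by (simp_all add: J\<^sub>0_def block_diag_def matrix_matrix_mult_def sum_8 cscale_component)

lemma block_diag_linear: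
  "block_diag a b + block_diag c d = block_diag (a + c) (b + d)"
  "cscale c (block_diag a b) = block_diag (c * a) (c * b)"
  "r *\<^sub>R block_diag a b = block_diag (r *\<^sub>R a) (r *\<^sub>R b)"
  by (simp_all add: vec_eq_iff block_diag_def cscale_component)

lemma block_diag_one: "block_diag 1 1 = mat 1"
  by (simp add: vec_eq_iff block_diag_def mat_def)

lemma mat_exp_J\<^sub>0: "mat_exp (cscale z J\<^sub>0) = rot z"
proof -
  let ?X = "cscale z J\<^sub>0"
  \<comment> \<open>The first block gets a contribution only from the zeroth power. On the rest,
    \<open>cos_coeff\<close> vanishes at odd and \<open>sin_coeff\<close> at even indices, so one
    formula covers both parities.\<close>
  let ?t = "\<lambda>k. block_diag (if k = 0 then 1 else 0) (cos_coeff k *\<^sub>R z ^ k)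
      + cscale (sin_coeff k *\<^sub>R z ^ k) J\<^sub>0"
  have step: "?X ** (block_diag a b + cscale s J\<^sub>0) = block_diag 0 (- (z * s)) + cscale (z * b) J\<^sub>0"
    for a b s
    by (simp add: cscale_mult matrix_add_ldistrib J\<^sub>0_mult block_diag_linear mult.commute)
  have eq: "inverse (fact k) *\<^sub>R (((**) ?X) ^^ k) (mat 1) = ?t k" for k
  proof (induction k)
    case 0
    then show ?case by (simp add: block_diag_one vec_eq_iff cscale_component)
  next
    case (Suc k)
    let ?r = "inverse (real (Suc k))"
    have "inverse (fact (Suc k)) *\<^sub>R (((**) ?X) ^^ Suc k) (mat 1) =
        ?r *\<^sub>R (?X ** (inverse (fact k) *\<^sub>R (((**) ?X) ^^ k) (mat 1)))"
      by (simp add: matrix_mult_scaleR)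
    also have "\<dots> = ?r *\<^sub>R (?X ** ?t k)"
      by (simp only: Suc)
    also have "\<dots> = block_diag 0 (?r *\<^sub>R (- (z * (sin_coeff k *\<^sub>R z ^ k))))
        + cscale (?r *\<^sub>R (z * (cos_coeff k *\<^sub>R z ^ k))) J\<^sub>0"
      by (simp only: step scaleR_add_right block_diag_linear cscale_scaleR scaleR_zero_right)
    also have "?r *\<^sub>R (- (z * (sin_coeff k *\<^sub>R z ^ k))) = cos_coeff (Suc k) *\<^sub>R z ^ Suc k"
      by (simp add: cos_coeff_Suc divide_inverse mult.commute)
    also have "?r *\<^sub>R (z * (cos_coeff k *\<^sub>R z ^ k)) = sin_coeff (Suc k) *\<^sub>R z ^ Suc k"
      by (simp add: sin_coeff_Suc divide_inverse mult.commute)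
    also have "block_diag 0 (cos_coeff (Suc k) *\<^sub>R z ^ Suc k)
        + cscale (sin_coeff (Suc k) *\<^sub>R z ^ Suc k) J\<^sub>0 = ?t (Suc k)"
      by simp
    finally show ?case .
  qed
  have "?t sums rot z"
  proof (rule matrix_sumsI)
    fix i j
    have "(\<lambda>k. (if k = 0 then 1 else 0) * block_diag 1 0 $ i $ j
          + (cos_coeff k *\<^sub>R z ^ k) * block_diag 0 1 $ i $ j
          + (sin_coeff k *\<^sub>R z ^ k) * J\<^sub>0 $ i $ j)
        sums (1 * block_diag 1 0 $ i $ j + cos z * block_diag 0 1 $ i $ j + sin z * J\<^sub>0 $ i $ j)"
      by (intro sums_add sums_mult2 cos_converges sin_converges)
        (use sums_single[of 0 "\<lambda>_. 1 :: complex"] in simp)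
    moreover have "?t k $ i $ j = (if k = 0 then 1 else 0) * block_diag 1 0 $ i $ j
          + (cos_coeff k *\<^sub>R z ^ k) * block_diag 0 1 $ i $ j
          + (sin_coeff k *\<^sub>R z ^ k) * J\<^sub>0 $ i $ j" for k
      by (simp add: block_diag_def cscale_component)
    moreover have "rot z $ i $ j
        = 1 * block_diag 1 0 $ i $ j + cos z * block_diag 0 1 $ i $ j + sin z * J\<^sub>0 $ i $ j"
      by (simp add: rot_def block_diag_def cscale_component)
    ultimately show "(\<lambda>k. ?t k $ i $ j) sums (rot z $ i $ j)"
      by (simp only:)
  qed
  then show ?thesis
    unfolding mat_exp_def eq by (rule sums_unique[symmetric])
qed

lemma rot_add: "rot w ** rot z = rot (w + z)"
  by (simp add: rot_def matrix_add_ldistrib matrix_mult_add_left cscale_mult J\<^sub>0_mult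
      block_diag_linear cos_add sin_add cmat.scale_left_distrib algebra_simps)

lemma rot_zero: "rot 0 = mat 1"
  by (simp add: rot_def block_diag_one)

lemma rot_transpose: "transpose (rot z) = rot (- z)"
  unfolding vec_eq_iff forall_8
  by (simp add: transpose_def rot_def block_diag_def J\<^sub>0_def cscale_component)

lemma rot_SO7C: "rot z \<in> SO7C"
proof -
  have orth: "transpose (rot z) ** rot z = mat 1" for z
    by (simp add: rot_transpose rot_add rot_zero)
  \<comment> \<open>An orthogonal matrix that is a square of an orthogonal matrix has determinant
    1.\<close>
  have "rot z = rot (z / 2) ** rot (z / 2)" by (simp add: rot_add)
  then have "det (rot z) = det (transpose (rot (z / 2)) ** rot (z / 2))"
    by (simp only: det_mul det_transpose)
  then have "det (rot z) = 1" by (simp add: orth)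
  moreover have "rot z *v axis 0 1 = axis 0 1"
    unfolding vec_eq_iff matrix_vector_axis forall_8
    by (simp add: rot_def block_diag_def J\<^sub>0_def cscale_component axis_def)
  ultimately show ?thesis by (simp add: SO7C_iff orth)
qed

lemma rot_SO7: "rot (complex_of_real t) \<in> SO7"
  using rot_SO7C[of t]
  by (simp add: SO7_def) (simp add: rot_def block_diag_def J\<^sub>0_def cscale_component cos_of_real sin_of_real)

lemma A\<^sub>0_eq: "A\<^sub>0 = range (\<lambda>t. rot (\<i> * complex_of_real t))"
  by (simp add: A\<^sub>0_def \<aa>\<^sub>0_def diag_delta_eq mat_exp_J\<^sub>0 image_image)

text \<open>Two half turns whose axes enclose the angle \<open>\<alpha>\<close> compose to a
  rotation by twice that angle in the plane of the axes; the signs cancel elsewhere.\<close>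

lemma plane_rotation:
  fixes \<alpha> :: complex
  assumes "a \<noteq> 0" "b \<noteq> 0" "a \<noteq> b"
  shows "(half_turn (axis a 1) *v (half_turn (cos \<alpha> *s axis a 1 + sin \<alpha> *s axis b 1) *v x)) $ i =
    (if i = a then cos (2 * \<alpha>) * x $ a + sin (2 * \<alpha>) * x $ b
     else if i = b then cos (2 * \<alpha>) * x $ b - sin (2 * \<alpha>) * x $ a else x $ i)"
proof -
  have c: "cos \<alpha> * (cos \<alpha> * y) = y - sin \<alpha> * (sin \<alpha> * y)" for y
    using sin_cos_squared_add[of \<alpha>] by (simp add: power2_eq_square algebra_simps flip: distrib_left)
  have d: "cos (2 * \<alpha>) = 1 - 2 * (sin \<alpha> * sin \<alpha>)" "sin (2 * \<alpha>) = 2 * (sin \<alpha> * cos \<alpha>)"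
    by (simp_all add: cos_double_sin sin_double power2_eq_square)
  show ?thesis
    unfolding d using assms
    by (auto simp: half_turn_works dot_linear dot_axis axis_component_8 algebra_simps c)
qed

text \<open>All three pairs satisfy \<open>e\<^sub>a e\<^sub>b = e\<^sub>1\<close>, so the lift of
  each plane rotation preserves the span of \<open>e\<^sub>0\<close> and \<open>e\<^sub>1\<close>
  and turns it by the single angle \<open>- \<alpha>\<close>, up to a sign.\<close>

lemma spinor_rotation:
  fixes \<alpha> \<beta> :: complex
  assumes "(a, b) \<in> {(2,3), (4,5), (6,7)}"
  shows "axis a 1 \<cdot>\<^sub>C ((cos \<alpha> *s axis a 1 + sin \<alpha> *s axis b 1) \<cdot>\<^sub>C (cos \<beta> *s axis 0 1 + sin \<beta> *s axis 1 1))
    = - (cos (\<beta> - \<alpha>) *s axis 0 1 + sin (\<beta> - \<alpha>) *s axis (1 :: 8) 1)"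
  using assms unfolding vec_eq_iff forall_8
  by (auto simp: cayley_mult_component axis_component_8 cos_diff sin_diff algebra_simps)

text \<open>The three plane rotations act in different planes on vectors but in the same plane on
  the spinor \<open>e\<^sub>0\<close>, where their angles add up to
  \<open>- 3 \<alpha>\<close>.\<close>

lemma spin_pair_rot:
  obtains M where "spin_pair (rot (- 2 * \<alpha>)) M"
    "M *v axis 0 1 = cos (3 * \<alpha>) *s axis 0 1 - sin (3 * \<alpha>) *s axis 1 1"
proof -
  define v where "v a b = cos \<alpha> *s axis a 1 + sin \<alpha> *s axis b (1::complex)" for a b :: 8
  define R where "R a b = half_turn (axis a 1) ** half_turn (v a b)" for a b
  define L where "L a b = left_mult (axis a 1) ** left_mult (v a b)" for a b
  have v: "v a b $ 0 = 0" "dot (v a b) (v a b) = 1" if "a \<noteq> 0" "b \<noteq> 0" "a \<noteq> b" for a b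
    using that sin_cos_squared_add[of \<alpha>]
    by (simp_all add: v_def dot_linear dot_axis axis_component_8 power2_eq_square)
  have RL: "spin_pair (R a b) (L a b)" if "a \<noteq> 0" "b \<noteq> 0" "a \<noteq> b" for a b
    unfolding R_def L_def using that v[OF that]
    by (intro spin_pair_mult spin_pair_half_turn) (simp_all add: axis_component_8 dot_axis)
  define s where "s \<beta> = cos \<beta> *s axis 0 1 + sin \<beta> *s axis (1::8) (1::complex)" for \<beta>
  have spinor: "L a b *v s \<beta> = - s (\<beta> - \<alpha>)" if "(a, b) \<in> {(2,3), (4,5), (6,7)}" for a b \<beta>
    unfolding L_def matrix_vector_mul_assoc[symmetric] left_mult_works v_def s_def
    by (rule spinor_rotation[OF that])
  have "R 2 3 ** (R 4 5 ** R 6 7) = rot (- 2 * \<alpha>)"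
    unfolding matrix_eq matrix_vector_mul_assoc[symmetric]
  proof
    fix x
    show "R 2 3 *v (R 4 5 *v (R 6 7 *v x)) = rot (- 2 * \<alpha>) *v x"
      unfolding R_def matrix_vector_mul_assoc[symmetric] v_def vec_eq_iff forall_8
      by (simp add: plane_rotation)
        (simp add: rot_def matrix_vector_mult_def sum_8 block_diag_def J\<^sub>0_def cscale_component)
  qed
  moreover have "spin_pair (R 2 3 ** (R 4 5 ** R 6 7)) (L 2 3 ** (L 4 5 ** L 6 7))"
    by (intro spin_pair_mult RL) simp_all
  \<comment> \<open>Each factor contributes a sign \<open>- 1\<close>; the product of the three is
    removed by passing to the other lift.\<close>
  ultimately have "spin_pair (rot (- 2 * \<alpha>)) (- (L 2 3 ** (L 4 5 ** L 6 7)))"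
    by (simp add: spin_pair_uminus)
  moreover have "(- (L 2 3 ** (L 4 5 ** L 6 7))) *v axis 0 1
      = cos (3 * \<alpha>) *s axis 0 1 - sin (3 * \<alpha>) *s axis 1 1"
  proof -
    have "axis 0 1 = s 0" by (simp add: s_def)
    moreover have "(- (L 2 3 ** (L 4 5 ** L 6 7))) *v s 0 = s (0 - \<alpha> - \<alpha> - \<alpha>)"
      by (simp only: matrix_vector_uminus matrix_vector_mul_assoc[symmetric] spinor vec.neg
          minus_minus insert_iff simp_thms)
    moreover have "s (0 - \<alpha> - \<alpha> - \<alpha>) = s (- (3 * \<alpha>))" by (rule arg_cong[of _ _ s]) simp
    ultimately show ?thesis by (simp only: s_def cos_minus sin_minus vector_smult_lneg) simp
  qed
  ultimately show thesis by (rule that)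
qed

section \<open>The decomposition\<close>

text \<open>An automorphism fixes the unit: \<open>g e\<^sub>0\<close> times \<open>g z\<close> is
  \<open>g z\<close>, and \<open>z\<close> is chosen with \<open>g z = e\<^sub>0\<close>.\<close>

lemma G2C_subset_SO7C: "G2C \<subseteq> SO7C"
proof
  fix g assume "g \<in> G2C"
  then have g: "g \<in> SO8C" "\<And>x y. (g *v x) \<cdot>\<^sub>C (g *v y) = g *v (x \<cdot>\<^sub>C y)"
    by (simp_all add: G2C_def)
  have inv: "g ** transpose g = mat 1"
    by (rule matrix_left_right_inverse1) (use g in \<open>simp add: SO8C_def\<close>)
  have "g *v axis 0 1 = (g *v axis 0 1) \<cdot>\<^sub>C (g *v (transpose g *v axis 0 1))"
    by (simp add: matrix_vector_mul_assoc inv cayley_unit)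
  also have "\<dots> = axis 0 1"
    by (simp add: g(2) cayley_unit) (simp add: matrix_vector_mul_assoc inv)
  finally show "g \<in> SO7C" using g by (simp add: SO7C_def)
qed

lemma SO7_subset_SO7C: "SO7 \<subseteq> SO7C"
  by (auto simp: SO7_def)

lemma A\<^sub>0_subset_SO7C: "A\<^sub>0 \<subseteq> SO7C"
  by (auto simp: A\<^sub>0_eq rot_SO7C)

lemma cos_i_times: "cos (\<i> * complex_of_real t) = complex_of_real (cosh t)"
  by (simp add: cosh_field_def flip: cosh_conv_cos exp_of_real)

lemma sin_i_times: "sin (\<i> * complex_of_real t) = \<i> * complex_of_real (sinh t)"
proof -
  have "\<i> * sinh (complex_of_real t) = sin (\<i> * complex_of_real t)"
    unfolding sinh_conv_sin by simp
  then show ?thesis by (simp add: sinh_field_def flip: exp_of_real)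
qed

lemma spin_pair_A\<^sub>0:
  fixes \<tau> :: real
  obtains a M where "a \<in> A\<^sub>0" "spin_pair a M"
    "M *v axis 0 1 = complex_of_real (cosh \<tau>) *s axis 0 1 + (\<i> * complex_of_real (sinh \<tau>)) *s axis 1 1"
proof -
  \<comment> \<open>The spinor angle is \<open>- 3 \<alpha>\<close>, which has to be
    \<open>\<i> \<tau>\<close>; the vector angle \<open>- 2 \<alpha>\<close> is then
    \<open>2 / 3\<close> of it.\<close>
  define \<alpha> where "\<alpha> = - (\<i> * complex_of_real (\<tau> / 3))"
  obtain M where M: "spin_pair (rot (- 2 * \<alpha>)) M"
    "M *v axis 0 1 = cos (3 * \<alpha>) *s axis 0 1 - sin (3 * \<alpha>) *s axis 1 1"
    by (rule spin_pair_rot)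
  have "- 2 * \<alpha> = \<i> * complex_of_real (2 * \<tau> / 3)" by (simp add: \<alpha>_def)
  then have a: "rot (- 2 * \<alpha>) \<in> A\<^sub>0" unfolding A\<^sub>0_eq by (metis rangeI)
  have alpha: "3 * \<alpha> = - (\<i> * complex_of_real \<tau>)" by (simp add: \<alpha>_def)
  have "cos (3 * \<alpha>) = complex_of_real (cosh \<tau>)" "sin (3 * \<alpha>) = - (\<i> * complex_of_real (sinh \<tau>))"
    unfolding alpha cos_minus sin_minus by (simp_all only: cos_i_times sin_i_times)
  then have "M *v axis 0 1 = complex_of_real (cosh \<tau>) *s axis 0 1 + (\<i> * complex_of_real (sinh \<tau>)) *s axis 1 1"
    unfolding M(2) by (simp add: vector_smult_lneg)
  then show thesis using that a M(1) by blast
qed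

lemma SO7C_decomposition:
  assumes "g \<in> SO7C"
  obtains k a h where "k \<in> SO7" "a \<in> A\<^sub>0" "h \<in> G2C" "g = k ** a ** h"
proof -
  obtain M where M: "spin_pair g M" using exists_spin_pair[OF assms] by blast
  define s where "s = M *v axis 0 1"
  have "dot s s = dot (axis 0 1) (axis (0::8) (1::complex))"
    using M by (simp only: s_def spin_pair_def orthogonal_iff_dot)
  then have ss: "dot s s = 1" by (simp add: dot_axis axis_component_8)
  define x y where "x = (\<chi> i. Re (s $ i))" and "y = (\<chi> i. Im (s $ i))"
  have s: "s = complexify x + \<i> *s complexify y"
    by (simp add: vec_eq_iff x_def y_def complexify_simps flip: complex_eq)
  have "dot s s = complex_of_real (dot x x - dot y y) + \<i> * complex_of_real (2 * dot x y)"
    unfolding s by (simp add: dot_linear complexify_simps dot_commute[of y x] algebra_simps)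
  then have xy: "dot x x - dot y y = 1" "dot x y = 0"
    using ss by (simp_all add: complex_eq_iff)
  have x0: "x \<noteq> 0"
  proof
    assume "x = 0"
    moreover have "dot y y \<ge> 0" by (simp add: dot_eq_inner)
    ultimately show False using xy(1) by (simp add: dot_linear)
  qed
  obtain T b where T: "real_spin T" "T x = norm x *s axis 0 1" "T y = b *s axis 1 1"
    using real_spin_transitive[OF xy(2) x0] by blast
  then obtain k N where N: "k \<in> SO7" "spin_pair k N" "\<And>z. N *v complexify z = complexify (T z)"
    unfolding real_spin_def by blast
  \<comment> \<open>Chosen so that \<open>sinh \<tau> = b\<close>; the relation between the squared
    norms then forces \<open>norm x = cosh \<tau>\<close>.\<close>
  define \<tau> where "\<tau> = arsinh b"
  have "dot (T x) (T x) - dot (T y) (T y) = 1"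
    by (simp only: real_spin_linear(1)[OF T(1)] xy)
  then have "(norm x)\<^sup>2 = (cosh \<tau>)\<^sup>2"
    by (simp add: T dot_linear dot_axis axis_component_8 power2_eq_square \<tau>_def cosh_square_eq[unfolded power2_eq_square])
  then have cosh: "norm x = cosh \<tau>" by (simp add: power2_eq_iff_nonneg)
  obtain a A where A: "a \<in> A\<^sub>0" "spin_pair a A"
    "A *v axis 0 1 = complex_of_real (cosh \<tau>) *s axis 0 1 + (\<i> * complex_of_real (sinh \<tau>)) *s axis 1 1"
    by (rule spin_pair_A\<^sub>0)
  have NM: "N *v (M *v axis 0 1) = A *v axis 0 1"
    unfolding s_def[symmetric] A(3) s
    by (simp add: matrix_vector_right_distrib matrix_vector_smult N T complexify_simps cosh \<tau>_def)
  \<comment> \<open>The lifts of \<open>a\<close> and of \<open>k ** g\<close> send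
    \<open>e\<^sub>0\<close> to the same spinor, so the lift of this quotient fixes
    \<open>e\<^sub>0\<close>.\<close>
  define h where "h = transpose a ** (k ** g)"
  have "spin_pair h (transpose A ** (N ** M))"
    unfolding h_def by (intro spin_pair_mult spin_pair_transpose A N M)
  moreover have "(transpose A ** (N ** M)) *v axis 0 1 = axis 0 1"
    using A(2) by (simp add: NM spin_pair_def flip: matrix_vector_mul_assoc)
      (simp add: matrix_vector_mul_assoc)
  ultimately have h: "h \<in> G2C" by (rule spin_pair_G2C)
  have ka: "k \<in> SO7C" "a \<in> SO7C" using N(1) A(1) SO7_subset_SO7C A\<^sub>0_subset_SO7C by auto
  have "transpose k ** a ** h = transpose k ** (a ** transpose a) ** k ** g"
    by (simp only: h_def matrix_mul_assoc)
  also have "\<dots> = g"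
    using ka SO7C_transpose(2)[OF ka(2)] by (simp add: SO7C_iff)
  finally have "g = transpose k ** a ** h" ..
  then show thesis using that SO7_transpose[OF N(1)] A(1) h by blast
qed

lemma SO7C_eq: "SO7C = {k ** a ** h | k a h. k \<in> SO7 \<and> a \<in> A\<^sub>0 \<and> h \<in> G2C}" (is "_ = ?R")
proof
  show "SO7C \<subseteq> ?R"
    using SO7C_decomposition by blast
  show "?R \<subseteq> SO7C"
    using SO7C_mult SO7_subset_SO7C A\<^sub>0_subset_SO7C G2C_subset_SO7C by blast
qed

lemma comm_group_A\<^sub>0: "comm_group (matrix_monoid A\<^sub>0)"
proof (rule comm_groupI)
  fix x assume "x \<in> carrier (matrix_monoid A\<^sub>0)"
  then obtain t where t: "x = rot (\<i> * complex_of_real t)"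
    by (auto simp: matrix_monoid_def A\<^sub>0_eq)
  have "rot (\<i> * complex_of_real (- t)) ** x = mat 1"
    by (simp add: t rot_add rot_zero)
  moreover have "rot (\<i> * complex_of_real (- t)) \<in> A\<^sub>0"
    unfolding A\<^sub>0_eq by (rule rangeI)
  ultimately show "\<exists>y\<in>carrier (matrix_monoid A\<^sub>0). y \<otimes>\<^bsub>matrix_monoid A\<^sub>0\<^esub> x = \<one>\<^bsub>matrix_monoid A\<^sub>0\<^esub>"
    by (auto simp: matrix_monoid_def)
next
  have "mat 1 \<in> A\<^sub>0" unfolding A\<^sub>0_eq rot_zero[symmetric] by (intro image_eqI[of _ _ 0]) simp_all
  then show "\<one>\<^bsub>matrix_monoid A\<^sub>0\<^esub> \<in> carrier (matrix_monoid A\<^sub>0)"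
    by (simp add: matrix_monoid_def)
next
  fix x y assume "x \<in> carrier (matrix_monoid A\<^sub>0)" "y \<in> carrier (matrix_monoid A\<^sub>0)"
  then obtain s t where st: "x = rot (\<i> * complex_of_real s)" "y = rot (\<i> * complex_of_real t)"
    by (auto simp: matrix_monoid_def A\<^sub>0_eq)
  have "x ** y = rot (\<i> * complex_of_real (s + t))" "y ** x = rot (\<i> * complex_of_real (s + t))"
    by (simp_all add: st rot_add algebra_simps)
  then show "x \<otimes>\<^bsub>matrix_monoid A\<^sub>0\<^esub> y \<in> carrier (matrix_monoid A\<^sub>0)"
    "x \<otimes>\<^bsub>matrix_monoid A\<^sub>0\<^esub> y = y \<otimes>\<^bsub>matrix_monoid A\<^sub>0\<^esub> x"
    unfolding matrix_monoid_def A\<^sub>0_eq by (simp_all del: of_real_add)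
qed (simp_all add: matrix_monoid_def matrix_mul_assoc)

section \<open>The matrix exponential\<close>

abbreviation mat_pow :: "complex ^ 'n ^ 'n \<Rightarrow> nat \<Rightarrow> complex ^ 'n ^ 'n" where
  "mat_pow X k \<equiv> (((**) X) ^^ k) (mat 1)"

lemma mat_pow_commute: "mat_pow X k ** X = X ** mat_pow X k"
  by (induction k) (simp_all flip: matrix_mul_assoc)

lemma scaleR_matrix_mult: "(r *\<^sub>R A) ** B = r *\<^sub>R (A ** (B :: complex ^ 'n ^ 'm))"
  by (simp add: vec_eq_iff matrix_matrix_mult_def scaleR_sum_right)

lemma mat_pow_scaleR: "mat_pow (t *\<^sub>R X) k = t ^ k *\<^sub>R mat_pow X k"
  by (induction k) (simp_all add: scaleR_matrix_mult matrix_mult_scaleR)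

text \<open>The sum of the norms of all entries dominates every row sum, which lets the exponential
  series be compared with that of a number.\<close>

lemma mat_pow_bound:
  "norm (mat_pow X k $ i $ j) \<le> (\<Sum>i\<in>UNIV. \<Sum>j\<in>UNIV. norm (X $ i $ j)) ^ k"
proof (induction k arbitrary: i)
  case 0
  then show ?case by (simp add: mat_def)
next
  case (Suc k)
  let ?C = "\<Sum>i\<in>UNIV. \<Sum>j\<in>UNIV. norm (X $ i $ j)"
  have "norm (mat_pow X (Suc k) $ i $ j) \<le> (\<Sum>l\<in>UNIV. norm (X $ i $ l * mat_pow X k $ l $ j))"
    by (simp add: matrix_matrix_mult_def norm_sum)
  also have "\<dots> \<le> (\<Sum>l\<in>UNIV. norm (X $ i $ l) * ?C ^ k)"
    by (intro sum_mono) (simp add: norm_mult mult_left_mono Suc)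
  also have "\<dots> = (\<Sum>l\<in>UNIV. norm (X $ i $ l)) * ?C ^ k"
    by (simp add: sum_distrib_right)
  also have "\<dots> \<le> ?C * ?C ^ k"
    by (intro mult_right_mono member_le_sum[of i UNIV "\<lambda>i. \<Sum>j\<in>UNIV. norm (X $ i $ j)"] zero_le_power sum_nonneg)
      (auto intro: sum_nonneg)
  finally show ?case by simp
qed

text \<open>The factor \<open>z ^ k\<close> presents each entry of the exponential curve as an
  everywhere convergent power series, ready for termwise differentiation.\<close>

lemma summable_mat_exp_component:
  fixes z :: complex
  shows "summable (\<lambda>k. (inverse (fact k) *\<^sub>R mat_pow X k $ i $ j) * z ^ k)"
proof (rule summable_comparison_test'[OF summable_exp])
  fix k
  let ?C = "\<Sum>i\<in>UNIV. \<Sum>j\<in>UNIV. norm (X $ i $ j)"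
  have "norm (mat_pow X k $ i $ j) * norm (z ^ k) \<le> ?C ^ k * norm (z ^ k)"
    by (intro mult_right_mono mat_pow_bound) simp
  then have "inverse (fact k) * (norm (mat_pow X k $ i $ j) * norm (z ^ k)) \<le> inverse (fact k) * (?C ^ k * norm (z ^ k))"
    by (rule mult_left_mono) simp
  then show "norm ((inverse (fact k) *\<^sub>R mat_pow X k $ i $ j) * z ^ k) \<le> inverse (fact k) * (?C * norm z) ^ k"
    by (simp add: norm_mult norm_power power_mult_distrib mult.assoc)
qed

lemma mat_exp_sums:
  "(\<lambda>k. inverse (fact k) *\<^sub>R mat_pow X k) sums mat_exp X"
proof -
  have "(\<lambda>k. inverse (fact k) *\<^sub>R mat_pow X k) sums
      (\<chi> i j. \<Sum>k. inverse (fact k) *\<^sub>R mat_pow X k $ i $ j)"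
  proof (rule matrix_sumsI)
    fix i j
    show "(\<lambda>k. (inverse (fact k) *\<^sub>R mat_pow X k) $ i $ j) sums
        ((\<chi> i j. \<Sum>k. inverse (fact k) *\<^sub>R mat_pow X k $ i $ j) $ i $ j)"
      using summable_sums[OF summable_mat_exp_component[of X i j 1]] by simp
  qed
  then show ?thesis unfolding mat_exp_def by (simp only: sums_unique[symmetric])
qed

lemma mat_exp_component:
  "mat_exp (t *\<^sub>R X) $ i $ j = (\<Sum>k. (inverse (fact k) *\<^sub>R mat_pow X k $ i $ j) * complex_of_real t ^ k)"
proof -
  have "(\<lambda>k. (inverse (fact k) *\<^sub>R mat_pow (t *\<^sub>R X) k) $ i $ j) sums (mat_exp (t *\<^sub>R X) $ i $ j)"
    by (intro bounded_linear.sums[OF bounded_linear_vec_nth] mat_exp_sums)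
  moreover have "(inverse (fact k) *\<^sub>R mat_pow (t *\<^sub>R X) k) $ i $ j =
      (inverse (fact k) *\<^sub>R mat_pow X k $ i $ j) * complex_of_real t ^ k" for k
    by (simp add: mat_pow_scaleR) (simp add: scaleR_conv_of_real)
  ultimately show ?thesis
    by (simp only: sums_iff)
qed

lemma has_vector_derivative_vecI:
  fixes f :: "real \<Rightarrow> ('b::real_normed_vector) ^ 'n"
  assumes "\<And>i. ((\<lambda>t. f t $ i) has_vector_derivative f' $ i) (at t)"
  shows "(f has_vector_derivative f') (at t)"
  unfolding has_vector_derivative_def has_derivative_at_within
proof (intro conjI bounded_linear_scaleR_left vec_tendstoI)
  fix i
  show "((\<lambda>y. ((f y - f t - (y - t) *\<^sub>R f') /\<^sub>R norm (y - t)) $ i) \<longlongrightarrow> 0 $ i) (at t)"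
    using assms[of i] by (simp add: has_vector_derivative_def has_derivative_at_within)
qed

lemma bounded_bilinear_matrix_mult:
  "bounded_bilinear ((**) :: complex ^ 'n ^ 'm \<Rightarrow> complex ^ 'k ^ 'n \<Rightarrow> complex ^ 'k ^ 'm)"
  unfolding bilinear_conv_bounded_bilinear[symmetric] bilinear_def
  by (auto intro!: linearI simp: matrix_add_ldistrib matrix_mult_add_left scaleR_matrix_mult matrix_mult_scaleR)

lemma bounded_linear_matrix_vector:
  "bounded_linear (\<lambda>A :: complex ^ 'n ^ 'm. A *v x)"
  unfolding linear_conv_bounded_linear[symmetric]
  by (intro linearI) (simp_all add: vec_eq_iff matrix_vector_mult_def sum.distrib distrib_right scaleR_sum_right)

lemma bounded_linear_transpose:
  "bounded_linear (transpose :: complex ^ 'n ^ 'm \<Rightarrow> complex ^ 'm ^ 'n)"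
  unfolding linear_conv_bounded_linear[symmetric]
  by (intro linearI) (simp_all add: vec_eq_iff transpose_def)

lemma bounded_bilinear_cayley:
  "bounded_bilinear ((\<cdot>\<^sub>C) :: complex ^ 8 \<Rightarrow> complex ^ 8 \<Rightarrow> complex ^ 8)"
proof -
  have "r *\<^sub>R x = complex_of_real r *s x" for r and x :: "complex ^ 8"
    by (simp add: vec_eq_iff) (simp add: scaleR_conv_of_real)
  then show ?thesis
    unfolding bilinear_conv_bounded_bilinear[symmetric] bilinear_def
    by (auto intro!: linearI simp: cayley_linear)
qed

lemma mat_exp_commute: "mat_exp X ** X = X ** mat_exp X"
proof -
  note bl = bounded_bilinear.bounded_linear_left[OF bounded_bilinear_matrix_mult, of X]
    bounded_bilinear.bounded_linear_right[OF bounded_bilinear_matrix_mult, of X]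
  have "(\<lambda>k. (inverse (fact k) *\<^sub>R mat_pow X k) ** X) sums (mat_exp X ** X)"
    by (rule bounded_linear.sums[OF bl(1) mat_exp_sums])
  moreover have "(\<lambda>k. X ** (inverse (fact k) *\<^sub>R mat_pow X k)) sums (X ** mat_exp X)"
    by (rule bounded_linear.sums[OF bl(2) mat_exp_sums])
  ultimately show ?thesis
    by (simp add: scaleR_matrix_mult matrix_mult_scaleR mat_pow_commute sums_iff)
qed

lemma mat_exp_has_derivative:
  "((\<lambda>t. mat_exp (t *\<^sub>R X)) has_vector_derivative (X ** mat_exp (t *\<^sub>R X))) (at t)"
proof (intro has_vector_derivative_vecI)
  fix i j
  define c where "c i k = inverse (fact k) *\<^sub>R mat_pow X k $ i $ j" for i k
  \<comment> \<open>The factor \<open>k + 1\<close> from differentiation cancels against the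
    factorial, and one factor \<open>X\<close> of the power is left over.\<close>
  have "diffs (c i) k = (\<Sum>l\<in>UNIV. X $ i $ l * c l k)" for k
  proof -
    have "inverse (fact k) * real (Suc k) * inverse (real (Suc k)) = (inverse (fact k) :: real)" by simp
    then have "diffs (c i) k = inverse (fact k) *\<^sub>R (mat_pow X (Suc k) $ i $ j)"
      by (simp add: diffs_def c_def scaleR_conv_of_real field_simps del: funpow.simps of_nat_Suc)
    also have "\<dots> = (\<Sum>l\<in>UNIV. X $ i $ l * c l k)"
      by (simp add: matrix_matrix_mult_def c_def scaleR_sum_right)
    finally show ?thesis .
  qed
  then have "(\<Sum>k. diffs (c i) k * complex_of_real t ^ k)
      = (\<Sum>k. \<Sum>l\<in>UNIV. X $ i $ l * (c l k * complex_of_real t ^ k))"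
    by (simp add: sum_distrib_right mult.assoc)
  also have "\<dots> = (\<Sum>l\<in>UNIV. \<Sum>k. X $ i $ l * (c l k * complex_of_real t ^ k))"
    by (intro suminf_sum summable_mult) (simp only: c_def summable_mat_exp_component)
  also have "\<dots> = (\<Sum>l\<in>UNIV. X $ i $ l * mat_exp (t *\<^sub>R X) $ l $ j)"
    by (simp only: mat_exp_component c_def suminf_mult[OF summable_mat_exp_component])
  also have "\<dots> = (X ** mat_exp (t *\<^sub>R X)) $ i $ j"
    by (simp add: matrix_matrix_mult_def)
  finally have eq: "(\<Sum>k. diffs (c i) k * complex_of_real t ^ k) = (X ** mat_exp (t *\<^sub>R X)) $ i $ j" .
  have "summable (\<lambda>k. c i k * y ^ k)" for y
    unfolding c_def by (rule summable_mat_exp_component)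
  from termdiffs_strong_converges_everywhere[OF this, of "complex_of_real t"]
  have "((\<lambda>z. \<Sum>k. c i k * z ^ k) has_field_derivative (X ** mat_exp (t *\<^sub>R X)) $ i $ j)
      (at (complex_of_real t))"
    unfolding eq .
  then show "((\<lambda>t. mat_exp (t *\<^sub>R X) $ i $ j) has_vector_derivative (X ** mat_exp (t *\<^sub>R X)) $ i $ j) (at t)"
    unfolding mat_exp_component c_def by (rule has_vector_derivative_real_field)
qed

lemma mat_exp_zero: "mat_exp 0 = (mat 1 :: complex ^ 'n ^ 'n)"
proof -
  have "(\<lambda>k. inverse (fact k) *\<^sub>R mat_pow (0 :: complex ^ 'n ^ 'n) k) = (\<lambda>k. if k = 0 then mat 1 else 0)"
  proof
    fix k
    show "inverse (fact k) *\<^sub>R mat_pow (0 :: complex ^ 'n ^ 'n) k = (if k = 0 then mat 1 else 0)"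
      by (cases k) (simp_all add: vec_eq_iff matrix_matrix_mult_def)
  qed
  then have "(\<lambda>k. if k = 0 then mat 1 else 0) sums mat_exp (0 :: complex ^ 'n ^ 'n)"
    using mat_exp_sums[of "0 :: complex ^ 'n ^ 'n"] by simp
  then show ?thesis using sums_single[of 0 "\<lambda>_. mat 1"] by (rule sums_unique2)
qed

lemma mat_exp_scaleR_commute: "mat_exp (t *\<^sub>R X) ** X = X ** mat_exp (t *\<^sub>R X)"
proof (cases "t = 0")
  case False
  then show ?thesis
    using mat_exp_commute[of "t *\<^sub>R X"] by (simp add: scaleR_matrix_mult matrix_mult_scaleR)
qed (simp add: mat_exp_zero)

text \<open>As a function of \<open>t\<close> the left side has derivative 0, since \<open>X\<close>
  commutes with its exponentials, and it is compared with its value at 0. The case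
  \<open>s = 0\<close> gives inverses, the case \<open>s = t\<close> gives halving.\<close>

lemma mat_exp_uminus_mult:
  fixes X :: "complex ^ 'n ^ 'n"
  shows
  "mat_exp (- (t *\<^sub>R X)) ** mat_exp ((t + s) *\<^sub>R X) = mat_exp (s *\<^sub>R X)"
proof -
  let ?F = "\<lambda>t. mat_exp (t *\<^sub>R X)"
  have F: "(?F has_vector_derivative (X ** ?F t)) (at t)" for t by (rule mat_exp_has_derivative)
  have F1: "((\<lambda>t. ?F (t + s)) has_vector_derivative (X ** ?F (t + s))) (at t)" for t
  proof -
    have "((\<lambda>t. t + s) has_vector_derivative 1) (at t)" by (auto intro!: derivative_eq_intros)
    from vector_diff_chain_at[OF this F] show ?thesis by (simp add: o_def)
  qed
  have F2: "((\<lambda>t. ?F (- t)) has_vector_derivative (- (X ** ?F (- t)))) (at t)" for t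
  proof -
    have "((\<lambda>t. - t) has_vector_derivative - 1) (at t)" by (auto intro!: derivative_eq_intros)
    from vector_diff_chain_at[OF this F] show ?thesis by (simp add: o_def)
  qed
  let ?K = "\<lambda>t. ?F (- t) ** ?F (t + s)"
  have "(?K has_vector_derivative 0) (at t)" for t
  proof -
    have "?F (- t) ** (X ** ?F (t + s)) + (- (X ** ?F (- t))) ** ?F (t + s) = 0"
    proof -
      have "?F (- t) ** X = X ** ?F (- t)"
        by (rule mat_exp_scaleR_commute)
      then have "?F (- t) ** (X ** ?F (t + s)) = (X ** ?F (- t)) ** ?F (t + s)"
        by (simp only: matrix_mul_assoc)
      moreover have "(- A) ** B = - (A ** B)" for A B :: "complex ^ 'n ^ 'n"
        by (simp add: vec_eq_iff matrix_matrix_mult_def sum_negf)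
      ultimately show ?thesis by simp
    qed
    then show ?thesis
      using bounded_bilinear.has_vector_derivative[OF bounded_bilinear_matrix_mult F2 F1, of t] by simp
  qed
  then obtain C where C: "\<And>t. ?K t = C"
    using has_vector_derivative_zero_constant[of UNIV ?K] by auto
  have "?K t = ?K 0" by (simp only: C)
  then show ?thesis by (simp add: mat_exp_zero)
qed

section \<open>Lie algebras\<close>

lemma mat_exp_transpose: "transpose (mat_exp X) = mat_exp (transpose X)"
proof -
  have "transpose (mat_pow X k) = mat_pow (transpose X) k" for k
    by (induction k) (simp_all add: matrix_transpose_mul mat_pow_commute transpose_mat)
  then have "transpose (inverse (fact k) *\<^sub>R mat_pow X k) = inverse (fact k) *\<^sub>R mat_pow (transpose X) k" for k
    by (simp add: vec_eq_iff transpose_def)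
  then have "(\<lambda>k. inverse (fact k) *\<^sub>R mat_pow (transpose X) k) sums transpose (mat_exp X)"
    using bounded_linear.sums[OF bounded_linear_transpose mat_exp_sums[of X]] by simp
  then show ?thesis using mat_exp_sums by (rule sums_unique2)
qed

lemma mat_exp_fixes:
  assumes "X *v x = 0"
  shows "mat_exp X *v x = x"
proof -
  have "(inverse (fact k) *\<^sub>R mat_pow X k) *v x = (if k = 0 then x else 0)" for k
  proof (cases k)
    case (Suc n)
    have "mat_pow X k *v x = (mat_pow X n ** X) *v x"
      by (simp only: Suc mat_pow_commute) simp
    then have "mat_pow X k *v x = 0"
      by (simp add: assms flip: matrix_vector_mul_assoc)
    then show ?thesis
      using Suc by (simp add: vec_eq_iff matrix_vector_mult_def flip: scaleR_sum_right)
  qed simp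
  then have "(\<lambda>k. if k = 0 then x else 0) sums (mat_exp X *v x)"
    using bounded_linear.sums[OF bounded_linear_matrix_vector mat_exp_sums[of X], of x] by simp
  then show ?thesis using sums_single[of 0 "\<lambda>_. x"] by (rule sums_unique2)
qed

lemma mat_exp_has_derivative_0:
  "((\<lambda>t. mat_exp (t *\<^sub>R X)) has_vector_derivative X) (at 0)"
  using mat_exp_has_derivative[of X 0] by (simp add: mat_exp_zero)

text \<open>Differentiating the defining equations at 0 gives one inclusion; conversely the
  exponential of a skew matrix has its transpose as inverse.\<close>

lemma lie_algebra_SO7C: "lie_algebra SO7C = {X. transpose X = - X \<and> X *v axis 0 1 = 0}"
proof (intro subset_antisym subsetI CollectI conjI)
  fix X assume X: "X \<in> lie_algebra SO7C"
  let ?F = "\<lambda>t. mat_exp (t *\<^sub>R X)"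
  have F: "transpose (?F t) ** ?F t = mat 1" "?F t *v axis 0 1 = axis 0 1" for t
    using X by (auto simp: lie_algebra_def SO7C_iff)
  have "((\<lambda>t. transpose (?F t) ** ?F t) has_vector_derivative
      (transpose (?F 0) ** X + transpose X ** ?F 0)) (at 0)"
    by (rule bounded_bilinear.has_vector_derivative[OF bounded_bilinear_matrix_mult
        bounded_linear.has_vector_derivative[OF bounded_linear_transpose mat_exp_has_derivative_0]
        mat_exp_has_derivative_0])
  then have "((\<lambda>t. mat 1) has_vector_derivative (X + transpose X)) (at (0::real))"
    by (simp add: F mat_exp_zero)
  then have "X + transpose X = 0"
    by (rule vector_derivative_unique_at) simp
  then show "transpose X = - X" by (simp add: eq_neg_iff_add_eq_0 add.commute)
  have "((\<lambda>t. ?F t *v axis 0 1) has_vector_derivative (X *v axis 0 1)) (at 0)"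
    by (rule bounded_linear.has_vector_derivative[OF bounded_linear_matrix_vector mat_exp_has_derivative_0])
  then have "((\<lambda>t. axis 0 1) has_vector_derivative (X *v axis 0 1)) (at (0::real))"
    by (simp add: F)
  then show "X *v axis 0 1 = 0"
    by (rule vector_derivative_unique_at) simp
next
  fix X :: "complex ^ 8 ^ 8" assume "X \<in> {X. transpose X = - X \<and> X *v axis 0 1 = 0}"
  then have X: "transpose X = - X" "X *v axis 0 1 = 0" by auto
  let ?F = "\<lambda>t. mat_exp (t *\<^sub>R X)"
  have tr: "transpose (?F t) = mat_exp (- (t *\<^sub>R X))" for t
  proof -
    have "transpose (t *\<^sub>R X) = t *\<^sub>R transpose X"
      by (simp add: vec_eq_iff transpose_def)
    also have "\<dots> = - (t *\<^sub>R X)" by (simp add: X(1))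
    finally have "transpose (t *\<^sub>R X) = - (t *\<^sub>R X)" .
    then show ?thesis by (simp add: mat_exp_transpose)
  qed
  have orth: "transpose (?F t) ** ?F t = mat 1" for t
    using mat_exp_uminus_mult[of t X 0] by (simp add: tr mat_exp_zero)
  have "?F t \<in> SO7C" for t
  proof -
    \<comment> \<open>Writing \<open>?F t\<close> as the square of the orthogonal matrix
      \<open>?F (t / 2)\<close> excludes determinant \<open>- 1\<close>.\<close>
    have inv: "?F (t / 2) ** mat_exp (- ((t / 2) *\<^sub>R X)) = mat 1"
      using matrix_left_right_inverse1[OF orth[of "t / 2"]] unfolding tr .
    have "?F t = (?F (t / 2) ** mat_exp (- ((t / 2) *\<^sub>R X))) ** ?F (t / 2 + t / 2)"
      unfolding inv matrix_mul_lid field_sum_of_halves ..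
    also have "\<dots> = ?F (t / 2) ** (mat_exp (- ((t / 2) *\<^sub>R X)) ** ?F (t / 2 + t / 2))"
      by (rule matrix_mul_assoc[symmetric])
    also have "\<dots> = ?F (t / 2) ** ?F (t / 2)"
      by (simp only: mat_exp_uminus_mult)
    finally have "?F t = ?F (t / 2) ** ?F (t / 2)" .
    then have "det (?F t) = det (transpose (?F (t / 2)) ** ?F (t / 2))"
      by (simp only: det_mul det_transpose)
    moreover have "?F t *v axis 0 1 = axis 0 1"
      using X(2) by (intro mat_exp_fixes) (simp add: vec_eq_iff matrix_vector_mult_def flip: scaleR_sum_right)
    ultimately show ?thesis by (simp add: SO7C_iff orth)
  qed
  then show "X \<in> lie_algebra SO7C" by (simp add: lie_algebra_def)
qed

lemma lie_algebra_mono: "G \<subseteq> H \<Longrightarrow> lie_algebra G \<subseteq> lie_algebra H"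
  by (auto simp: lie_algebra_def)

lemma lie_algebra_G2C_derivation:
  assumes "X \<in> lie_algebra G2C"
  shows "X *v (x \<cdot>\<^sub>C y) = (X *v x) \<cdot>\<^sub>C y + x \<cdot>\<^sub>C (X *v y)"
proof -
  let ?F = "\<lambda>t. mat_exp (t *\<^sub>R X)"
  have F: "((\<lambda>t. ?F t *v z) has_vector_derivative (X *v z)) (at 0)" for z
    by (rule bounded_linear.has_vector_derivative[OF bounded_linear_matrix_vector mat_exp_has_derivative_0])
  have "((\<lambda>t. (?F t *v x) \<cdot>\<^sub>C (?F t *v y)) has_vector_derivative
      ((?F 0 *v x) \<cdot>\<^sub>C (X *v y) + (X *v x) \<cdot>\<^sub>C (?F 0 *v y))) (at 0)"
    by (rule bounded_bilinear.has_vector_derivative[OF bounded_bilinear_cayley F F])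
  moreover have "(?F t *v x) \<cdot>\<^sub>C (?F t *v y) = ?F t *v (x \<cdot>\<^sub>C y)" for t
    using assms by (simp add: lie_algebra_def G2C_def)
  ultimately have "((\<lambda>t. ?F t *v (x \<cdot>\<^sub>C y)) has_vector_derivative
      (x \<cdot>\<^sub>C (X *v y) + (X *v x) \<cdot>\<^sub>C y)) (at 0)"
    by (simp add: mat_exp_zero)
  from vector_derivative_unique_at[OF F this] show ?thesis by (simp add: add.commute)
qed

text \<open>The coefficients of \<open>e\<^sub>7\<close> are compared; on the right they come from
  \<open>e\<^sub>3 e\<^sub>4 = e\<^sub>7\<close> and
  \<open>e\<^sub>2 e\<^sub>5 = e\<^sub>7\<close>.\<close>

lemma lie_algebra_G2C_entries:
  assumes "X \<in> lie_algebra G2C"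
  shows "X $ 3 $ 2 + X $ 5 $ 4 + X $ 7 $ 6 = 0"
proof -
  have "axis 2 1 \<cdot>\<^sub>C axis 4 1 = - (axis 6 1 :: complex ^ 8)"
    unfolding vec_eq_iff forall_8 by (simp add: cayley_mult_component axis_component_8)
  then have "- (X *v axis 6 1) = (X *v axis 2 1) \<cdot>\<^sub>C axis 4 1 + axis 2 1 \<cdot>\<^sub>C (X *v axis 4 1)"
    using lie_algebra_G2C_derivation[OF assms, of "axis 2 1" "axis 4 1"] by (simp add: vec.neg)
  then have "(- (X *v axis 6 1)) $ 7 = ((X *v axis 2 1) \<cdot>\<^sub>C axis 4 1 + axis 2 1 \<cdot>\<^sub>C (X *v axis 4 1)) $ 7"
    by simp
  then have "- (X $ 7 $ 6) = X $ 3 $ 2 + X $ 5 $ 4"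
    by (simp add: cayley_mult_component axis_component_8 matrix_vector_axis)
  then have "X $ 3 $ 2 + X $ 5 $ 4 = - (X $ 7 $ 6)" by (rule sym)
  then show ?thesis by simp
qed

section \<open>The Lie algebra and the dimension of \<open>A\<^sub>0\<close>\<close>

lemma diag_delta_scaleR: "r *\<^sub>R diag_delta t = diag_delta (r * t)"
  by (simp add: diag_delta_eq cscale_scaleR) (simp add: scaleR_conv_of_real ac_simps)

lemma has_vector_derivative_quotient:
  assumes "(f has_vector_derivative f') (at x)"
  shows "((\<lambda>h. (f (x + h) - f x) /\<^sub>R h) \<longlongrightarrow> f') (at 0)"
proof (rule LIM_zero_cancel, rule tendsto_norm_zero_cancel)
  have "((\<lambda>h. norm (f (x + h) - f x - h *\<^sub>R f') / norm h) \<longlongrightarrow> 0) (at 0)"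
    using assms by (simp add: has_vector_derivative_def has_derivative_at)
  moreover have "norm (f (x + h) - f x - h *\<^sub>R f') / norm h = norm ((f (x + h) - f x) /\<^sub>R h - f')"
    if "h \<noteq> 0" for h
  proof -
    have "f (x + h) - f x - h *\<^sub>R f' = h *\<^sub>R ((f (x + h) - f x) /\<^sub>R h - f')"
      using that by (simp add: scaleR_diff_right)
    then show ?thesis using that by simp
  qed
  then have "\<forall>\<^sub>F h in at 0. norm (f (x + h) - f x - h *\<^sub>R f') / norm h
      = norm ((f (x + h) - f x) /\<^sub>R h - f')"
    by (simp add: eventually_at_filter)
  ultimately show "((\<lambda>h. norm ((f (x + h) - f x) /\<^sub>R h - f')) \<longlongrightarrow> 0) (at 0)"
    by (rule Lim_transform_eventually)
qed

text \<open>All differences \<open>a - mat 1\<close> lie in a real plane \<open>V\<close>. It is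
  closed, so it contains the velocity \<open>X\<close> of any one-parameter group in
  \<open>A\<^sub>0\<close>, and skewness singles out the line \<open>\<aa>\<^sub>0\<close> in
  it.\<close>

lemma lie_algebra_A\<^sub>0: "lie_algebra A\<^sub>0 = \<aa>\<^sub>0"
proof
  show "\<aa>\<^sub>0 \<subseteq> lie_algebra A\<^sub>0"
  proof
    fix X assume "X \<in> \<aa>\<^sub>0"
    then obtain s where X: "X = diag_delta s" by (auto simp: \<aa>\<^sub>0_def)
    have "t *\<^sub>R X = diag_delta (t * s)" for t
      by (simp only: X diag_delta_scaleR)
    then show "X \<in> lie_algebra A\<^sub>0"
      by (simp add: lie_algebra_def A\<^sub>0_def \<aa>\<^sub>0_def)
  qed
next
  show "lie_algebra A\<^sub>0 \<subseteq> \<aa>\<^sub>0"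
  proof
    fix X assume X: "X \<in> lie_algebra A\<^sub>0"
    define V where "V = span {block_diag 0 1, diag_delta 1}"
    have sub: "a - mat 1 \<in> V" if "a \<in> A\<^sub>0" for a
    proof -
      obtain t where a: "a = rot (\<i> * complex_of_real t)" using \<open>a \<in> A\<^sub>0\<close> by (auto simp: A\<^sub>0_eq)
      have "a - mat 1 = (cosh t - 1) *\<^sub>R block_diag 0 1 + sinh t *\<^sub>R diag_delta 1"
        by (simp add: a rot_def cos_i_times sin_i_times block_diag_linear diag_delta_eq cscale_scaleR
            vec_eq_iff cscale_component) (simp add: block_diag_def mat_def scaleR_conv_of_real)
      also have "\<dots> \<in> V"
        unfolding V_def by (intro span_add span_scale span_base) auto
      finally show ?thesis .
    qed
    have "((\<lambda>y. (mat_exp (y *\<^sub>R X) - mat_exp (0 *\<^sub>R X)) /\<^sub>R (y - 0)) \<longlongrightarrow> X) (at 0)"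
      using has_vector_derivative_quotient[OF mat_exp_has_derivative_0[of X]] by simp
    moreover have "(mat_exp (y *\<^sub>R X) - mat_exp (0 *\<^sub>R X)) /\<^sub>R (y - 0) \<in> V" for y
      using sub[of "mat_exp (y *\<^sub>R X)"] X
      by (auto simp: V_def mat_exp_zero lie_algebra_def intro: span_scale)
    moreover have "closed V" unfolding V_def by (rule closed_span)
    ultimately have "X \<in> V" by (intro Lim_in_closed_set[of V _ "at (0::real)"]) auto
    then obtain a b where ab: "X = a *\<^sub>R block_diag 0 1 + b *\<^sub>R diag_delta 1"
      unfolding V_def by (auto simp: span_insert span_singleton algebra_simps)
    have "X \<in> lie_algebra SO7C" using X lie_algebra_mono[OF A\<^sub>0_subset_SO7C] by blast
    \<comment> \<open>The diagonal entry of \<open>X\<close> at 2 is the coefficient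
      \<open>a\<close>, and a skew matrix has zero diagonal.\<close>
    then have "transpose X $ 2 $ 2 = (- X) $ 2 $ 2" by (simp add: lie_algebra_SO7C)
    then have "a = 0"
      by (simp add: ab transpose_def block_diag_def diag_delta_def)
    then have "X = diag_delta b"
      by (simp add: ab diag_delta_scaleR)
    then show "X \<in> \<aa>\<^sub>0" by (simp add: \<aa>\<^sub>0_def)
  qed
qed

lemma dim_\<aa>\<^sub>0: "dim \<aa>\<^sub>0 = 1"
proof -
  have "\<aa>\<^sub>0 = range (\<lambda>t. t *\<^sub>R diag_delta 1)"
    unfolding \<aa>\<^sub>0_def by (simp add: diag_delta_scaleR)
  also have "\<dots> = span {diag_delta 1}" by (simp add: span_singleton)
  finally have a: "\<aa>\<^sub>0 = span {diag_delta 1}" .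
  have "dim \<aa>\<^sub>0 = dim {diag_delta 1}" unfolding a by (rule dim_span)
  moreover have "diag_delta 1 $ 2 $ 3 \<noteq> 0" by (simp add: diag_delta_def)
  then have "diag_delta 1 \<noteq> 0" by auto
  ultimately show ?thesis by (simp add: dim_singleton)
qed

section \<open>The Killing form\<close>

text \<open>The matrix \<open>E\<^sub>i\<^sub>j - E\<^sub>j\<^sub>i\<close> in terms of elementary
  matrices; it is zero for \<open>i = j\<close>.\<close>

definition skew_unit :: "8 \<Rightarrow> 8 \<Rightarrow> complex ^ 8 ^ 8" where
  "skew_unit i j = (\<chi> k l. (if k = i \<and> l = j then 1 else 0) - (if k = j \<and> l = i then 1 else 0))"

lemma skew_unit_SO7C: "i \<noteq> 0 \<Longrightarrow> j \<noteq> 0 \<Longrightarrow> skew_unit i j \<in> lie_algebra SO7C"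
proof -
  assume ij: "i \<noteq> 0" "j \<noteq> 0"
  have "transpose (skew_unit i j) = - skew_unit i j"
    by (simp add: transpose_def skew_unit_def vec_eq_iff conj_commute)
  moreover have "skew_unit i j *v axis 0 1 = 0"
    using ij by (simp add: vec_eq_iff[of _ 0] matrix_vector_axis) (simp add: skew_unit_def)
  ultimately show ?thesis by (simp add: lie_algebra_SO7C)
qed

lemma lie_algebra_SO7C_entries:
  assumes "Z \<in> lie_algebra SO7C"
  shows "Z $ j $ i = - Z $ i $ j" "Z $ i $ i = 0" "Z $ i $ 0 = 0" "Z $ 0 $ i = 0"
proof -
  have skew: "Z $ j $ i = - Z $ i $ j" for i j
  proof -
    have "transpose Z $ i $ j = (- Z) $ i $ j" using assms by (simp add: lie_algebra_SO7C)
    then show ?thesis by (simp add: transpose_def)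
  qed
  then show "Z $ j $ i = - Z $ i $ j" .
  show "Z $ i $ i = 0" using skew[of i i] by simp
  have "(Z *v axis 0 1) $ i = 0" using assms by (simp add: lie_algebra_SO7C)
  then show "Z $ i $ 0 = 0" by (simp add: matrix_vector_axis)
  then show "Z $ 0 $ i = 0" using skew[of i 0] by simp
qed

lemma sum_delta_pair:
  fixes f :: "'a::finite \<Rightarrow> 'a \<Rightarrow> complex"
  assumes "k \<in> A" "l \<in> A"
  shows "(\<Sum>i\<in>A. \<Sum>j\<in>A. f i j * (if k = i \<and> l = j then 1 else 0)) = f k l"
proof -
  have "(\<Sum>i\<in>A. \<Sum>j\<in>A. f i j * (if k = i \<and> l = j then 1 else 0)) = (\<Sum>i\<in>A. if k = i then f i l else 0)"
    using assms by (intro sum.cong refl) (auto simp: if_distrib cong: if_cong)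
  then show ?thesis using assms by simp
qed

text \<open>The factor \<open>1 / 2\<close> compensates for running over ordered pairs:
  \<open>(i, j)\<close> and \<open>(j, i)\<close> give the same summand.\<close>

lemma lie_algebra_SO7C_expansion:
  assumes "Z \<in> lie_algebra SO7C"
  shows "Z = (\<Sum>i\<in>-{0}. \<Sum>j\<in>-{0}. cscale (Z $ i $ j / 2) (skew_unit i j))"
proof -
  note Z = lie_algebra_SO7C_entries[OF assms]
  have "(\<Sum>i\<in>-{0}. \<Sum>j\<in>-{0}. cscale (Z $ i $ j / 2) (skew_unit i j)) $ k $ l = Z $ k $ l" for k l
  proof (cases "k = 0 \<or> l = 0")
    case True
    then show ?thesis
      by (auto simp: Z(3,4) sum_component cscale_component skew_unit_def intro!: sum.neutral)
  next
    case False
    then have kl: "k \<in> -{0}" "l \<in> -{0}" by auto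
    have "(\<Sum>i\<in>-{0}. \<Sum>j\<in>-{0}. cscale (Z $ i $ j / 2) (skew_unit i j)) $ k $ l
        = (\<Sum>i\<in>-{0}. \<Sum>j\<in>-{0}. (Z $ i $ j / 2) * (if k = i \<and> l = j then 1 else 0))
        - (\<Sum>i\<in>-{0}. \<Sum>j\<in>-{0}. (Z $ i $ j / 2) * (if l = i \<and> k = j then 1 else 0))"
      unfolding sum_subtractf[symmetric] sum_component cscale_component skew_unit_def
      by (intro sum.cong refl) (auto simp: algebra_simps)
    also have "\<dots> = Z $ k $ l / 2 - Z $ l $ k / 2"
      by (simp only: sum_delta_pair[OF kl] sum_delta_pair[OF kl(2,1)])
    also have "\<dots> = Z $ k $ l" by (simp add: Z(1)[of k l])
    finally show ?thesis .
  qed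
  then show ?thesis by (simp add: vec_eq_iff)
qed

lemma bracket_SO7C:
  assumes "X \<in> lie_algebra SO7C" "Y \<in> lie_algebra SO7C"
  shows "bracket X Y \<in> lie_algebra SO7C"
proof -
  have neg: "(- A) ** B = - (A ** B)" "A ** (- B) = - (A ** B)" for A B :: "complex ^ 8 ^ 8"
    by (simp_all add: vec_eq_iff matrix_matrix_mult_def sum_negf)
  have "transpose (A - B) = transpose A - transpose B" for A B :: "complex ^ 8 ^ 8"
    by (simp add: vec_eq_iff transpose_def)
  then show ?thesis
    using assms by (simp add: lie_algebra_SO7C bracket_def matrix_transpose_mul neg
        matrix_vector_mult_diff_rdistrib flip: matrix_vector_mul_assoc)
qed

lemma cscale_SO7C:
  assumes "X \<in> lie_algebra SO7C"
  shows "cscale c X \<in> lie_algebra SO7C"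
proof -
  have X: "transpose X = - X" "X *v axis 0 1 = 0"
    using assms by (simp_all add: lie_algebra_SO7C)
  have "transpose (cscale c X) = cscale c (transpose X)"
    by (simp add: vec_eq_iff transpose_def cscale_component)
  also have "\<dots> = - cscale c X" unfolding X(1) by simp
  finally have "transpose (cscale c X) = - cscale c X" .
  moreover have "cscale c X *v axis 0 1 = c *s (X *v axis 0 1)"
    by (simp add: vec_eq_iff matrix_vector_axis cscale_component)
  ultimately show ?thesis using X(2) by (simp add: lie_algebra_SO7C)
qed

lemma subspace_SO7C: "cmat.subspace (lie_algebra SO7C)"
proof (rule cmat.subspaceI)
  show "0 \<in> lie_algebra SO7C"
    by (simp add: lie_algebra_SO7C vec_eq_iff transpose_def)
  show "X + Y \<in> lie_algebra SO7C" if "X \<in> lie_algebra SO7C" "Y \<in> lie_algebra SO7C" for X Y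
  proof -
    have "transpose (X + Y) = transpose X + transpose Y"
      by (simp add: vec_eq_iff transpose_def)
    then show ?thesis using that by (simp add: lie_algebra_SO7C matrix_vector_mult_add_rdistrib)
  qed
qed (rule cscale_SO7C)

text \<open>The trace is taken over an unspecified basis. It is evaluated with the redundant
  spanning family \<open>skew_unit i j\<close>, by the same exchange of sums that proves the trace
  to be independent of the basis.\<close>

lemma trace_on_SO7C:
  assumes lin: "Vector_Spaces.linear cscale cscale f"
    and maps: "\<And>Z. Z \<in> lie_algebra SO7C \<Longrightarrow> f Z \<in> lie_algebra SO7C"
  shows "trace_on (lie_algebra SO7C) f = (\<Sum>i\<in>-{0}. \<Sum>j\<in>-{0}. f (skew_unit i j) $ i $ j) / 2"
proof -
  interpret f: Vector_Spaces.linear cscale cscale f by (rule lin)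
  let ?L = "lie_algebra SO7C"
  define B where "B = (SOME B. B \<subseteq> ?L \<and> cmat.independent B \<and> cmat.span B = ?L)"
  \<comment> \<open>Existence of a basis gives the choice in \<open>trace_on\<close> its intended
    properties.\<close>
  have "\<exists>B. B \<subseteq> ?L \<and> cmat.independent B \<and> cmat.span B = ?L"
    by (metis cmat.maximal_independent_subset cmat.span_subspace subspace_SO7C)
  then have B: "B \<subseteq> ?L" "cmat.independent B" "cmat.span B = ?L"
    unfolding B_def by (rule someI2_ex, blast)+
  let ?F = "(\<lambda>(i, j). skew_unit i j) ` ((- {0}) \<times> (- {0}))"
  have "B \<subseteq> cmat.span ?F"
  proof
    fix b assume "b \<in> B"
    then have "b = (\<Sum>i\<in>-{0}. \<Sum>j\<in>-{0}. cscale (b $ i $ j / 2) (skew_unit i j))"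
      using B(1) by (intro lie_algebra_SO7C_expansion) auto
    also have "\<dots> \<in> cmat.span ?F"
      by (intro cmat.span_sum cmat.span_scale cmat.span_base) auto
    finally show "b \<in> cmat.span ?F" .
  qed
  then have fin: "finite B"
    using cmat.independent_span_bound[of ?F B] B(2) by simp
  have F: "f (skew_unit i j) \<in> cmat.span B" if "i \<in> -{0}" "j \<in> -{0}" for i j
    using that by (simp add: B maps skew_unit_SO7C)
  have rep: "cmat.representation B (f b) b
      = (\<Sum>i\<in>-{0}. \<Sum>j\<in>-{0}. (b $ i $ j / 2) * cmat.representation B (f (skew_unit i j)) b)"
    if "b \<in> B" for b
  proof -
    have "f b = f (\<Sum>i\<in>-{0}. \<Sum>j\<in>-{0}. cscale (b $ i $ j / 2) (skew_unit i j))"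
      using lie_algebra_SO7C_expansion[of b] B(1) that by auto
    also have "\<dots> = (\<Sum>i\<in>-{0}. \<Sum>j\<in>-{0}. cscale (b $ i $ j / 2) (f (skew_unit i j)))"
      by (simp only: f.sum f.scale)
    finally have "f b = (\<Sum>i\<in>-{0}. \<Sum>j\<in>-{0}. cscale (b $ i $ j / 2) (f (skew_unit i j)))" .
    then have "cmat.representation B (f b) b = cmat.representation B
        (\<Sum>i\<in>-{0}. \<Sum>j\<in>-{0}. cscale (b $ i $ j / 2) (f (skew_unit i j))) b" by simp
    also have "\<dots> = (\<Sum>i\<in>-{0}. \<Sum>j\<in>-{0}.
        cmat.representation B (cscale (b $ i $ j / 2) (f (skew_unit i j))) b)"
    proof -
      have "cscale (b $ i $ j / 2) (f (skew_unit i j)) \<in> cmat.span B" if "i \<in> -{0}" "j \<in> -{0}" for i j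
        by (rule cmat.span_scale[OF F[OF that]])
      note span = this
      have "cmat.representation B (\<Sum>j\<in>-{0}. cscale (b $ i $ j / 2) (f (skew_unit i j))) b
          = (\<Sum>j\<in>-{0}. cmat.representation B (cscale (b $ i $ j / 2) (f (skew_unit i j))) b)"
        if "i \<in> -{0}" for i
        by (subst cmat.representation_sum[OF B(2)]) (rule span[OF that], assumption, rule refl)
      moreover have "(\<Sum>j\<in>-{0}. cscale (b $ i $ j / 2) (f (skew_unit i j))) \<in> cmat.span B"
        if "i \<in> -{0}" for i
        by (intro cmat.span_sum span[OF that])
      ultimately show ?thesis
        by (subst cmat.representation_sum[OF B(2)]) (blast, rule sum.cong[OF refl], blast)
    qed
    also have "\<dots> = (\<Sum>i\<in>-{0}. \<Sum>j\<in>-{0}. (b $ i $ j / 2) * cmat.representation B (f (skew_unit i j)) b)"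
      using F by (intro sum.cong refl) (simp add: cmat.representation_scale[OF B(2)])
    finally show ?thesis .
  qed
  have coord: "(\<Sum>b\<in>B. b $ i $ j * cmat.representation B w b) = w $ i $ j"
    if "w \<in> cmat.span B" for w i j
  proof -
    have "(\<Sum>b\<in>B. cscale (cmat.representation B w b) b) $ i $ j = w $ i $ j"
      by (simp only: cmat.sum_representation_eq[OF B(2) that fin subset_refl])
    then show ?thesis by (simp add: sum_component cscale_component mult.commute)
  qed
  have "trace_on ?L f = (\<Sum>b\<in>B. cmat.representation B (f b) b)"
    by (simp add: trace_on_def B_def Let_def)
  also have "\<dots> = (\<Sum>b\<in>B. \<Sum>i\<in>-{0}. \<Sum>j\<in>-{0}. (b $ i $ j / 2) * cmat.representation B (f (skew_unit i j)) b)"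
    by (rule sum.cong[OF refl rep])
  \<comment> \<open>With the sum over \<open>B\<close> innermost, \<open>coord\<close> collapses it
    to an entry of the image of \<open>skew_unit i j\<close>.\<close>
  also have "\<dots> = (\<Sum>i\<in>-{0}. \<Sum>j\<in>-{0}. \<Sum>b\<in>B. (b $ i $ j / 2) * cmat.representation B (f (skew_unit i j)) b)"
    by (subst sum.swap, intro sum.cong refl, rule sum.swap)
  also have "\<dots> = (\<Sum>i\<in>-{0}. \<Sum>j\<in>-{0}. f (skew_unit i j) $ i $ j / 2)"
  proof (intro sum.cong refl)
    fix i j :: 8 assume "i \<in> -{0}" "j \<in> -{0}"
    then show "(\<Sum>b\<in>B. (b $ i $ j / 2) * cmat.representation B (f (skew_unit i j)) b) = f (skew_unit i j) $ i $ j / 2"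
      using coord[OF F, of i j i j] by (simp flip: sum_divide_distrib)
  qed
  finally show ?thesis by (simp add: sum_divide_distrib)
qed

lemma skew_unit_mult:
  "(A ** skew_unit i j) $ k $ l = A $ k $ i * (if l = j then 1 else 0) - A $ k $ j * (if l = i then 1 else 0)"
  "(skew_unit i j ** A) $ k $ l = (if k = i then 1 else 0) * A $ j $ l - (if k = j then 1 else 0) * A $ i $ l"
proof -
  have "(A ** skew_unit i j) $ k $ l = (\<Sum>m\<in>UNIV. if m = i then A $ k $ m * (if l = j then 1 else 0) else 0)
      - (\<Sum>m\<in>UNIV. if m = j then A $ k $ m * (if l = i then 1 else 0) else 0)"
    unfolding sum_subtractf[symmetric] matrix_matrix_mult_def skew_unit_def vec_lambda_beta
    by (rule sum.cong) auto
  then show "(A ** skew_unit i j) $ k $ l = A $ k $ i * (if l = j then 1 else 0) - A $ k $ j * (if l = i then 1 else 0)"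
    by simp
  have "(skew_unit i j ** A) $ k $ l = (\<Sum>m\<in>UNIV. if m = j then (if k = i then 1 else 0) * A $ m $ l else 0)
      - (\<Sum>m\<in>UNIV. if m = i then (if k = j then 1 else 0) * A $ m $ l else 0)"
    unfolding sum_subtractf[symmetric] matrix_matrix_mult_def skew_unit_def vec_lambda_beta
    by (rule sum.cong) auto
  then show "(skew_unit i j ** A) $ k $ l = (if k = i then 1 else 0) * A $ j $ l - (if k = j then 1 else 0) * A $ i $ l"
    by simp
qed

text \<open>Skewness of \<open>Y\<close> swaps its indices with a sign, and the omitted index 0
  contributes nothing because row 0 of \<open>X\<close> vanishes.\<close>

lemma trace_mult_SO7C:
  assumes X: "X \<in> lie_algebra SO7C" and Y: "Y \<in> lie_algebra SO7C"
  shows "(\<Sum>i\<in>-{0}. (X ** Y) $ i $ i) = - (\<Sum>i\<in>UNIV. \<Sum>j\<in>UNIV. X $ i $ j * Y $ i $ j)"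
proof -
  have "X $ i $ j * Y $ j $ i = - (X $ i $ j * Y $ i $ j)" for i j
    by (subst lie_algebra_SO7C_entries(1)[OF Y, of j i]) simp
  then have "(\<Sum>i\<in>-{0}. (X ** Y) $ i $ i) = (\<Sum>i\<in>-{0}. \<Sum>j\<in>UNIV. - (X $ i $ j * Y $ i $ j))"
    by (simp add: matrix_matrix_mult_def)
  also have "\<dots> = (\<Sum>i\<in>UNIV. \<Sum>j\<in>UNIV. - (X $ i $ j * Y $ i $ j))"
    by (intro sum.mono_neutral_left) (auto simp: lie_algebra_SO7C_entries(4)[OF X])
  finally show ?thesis by (simp add: sum_negf)
qed

text \<open>With \<open>?S\<close> for the sum on the right, the two trace terms give
  \<open>- 6 ?S\<close> each and the mixed terms give \<open>2 ?S\<close>; half of the total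
  \<open>- 10 ?S\<close> remains.\<close>

lemma killing_form_SO7C:
  assumes X: "X \<in> lie_algebra SO7C" and Y: "Y \<in> lie_algebra SO7C"
  shows "killing_form (lie_algebra SO7C) X Y = - 5 * (\<Sum>i\<in>UNIV. \<Sum>j\<in>UNIV. X $ i $ j * Y $ i $ j)"
proof -
  let ?f = "\<lambda>Z. bracket X (bracket Y Z)"
  let ?S = "\<Sum>i\<in>UNIV. \<Sum>j\<in>UNIV. X $ i $ j * Y $ i $ j"
  let ?I = "-{0} :: 8 set"
  have diff: "A ** (B - C) = A ** B - A ** C" "(B - C) ** A = B ** A - C ** A" for A B C :: "complex ^ 8 ^ 8"
    by (simp_all add: vec_eq_iff matrix_matrix_mult_def sum_subtractf algebra_simps)
  have br: "?f Z = (X ** Y) ** Z - X ** (Z ** Y) - Y ** (Z ** X) + Z ** (Y ** X)" for Z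
    by (simp add: bracket_def diff matrix_mul_assoc algebra_simps)
  have "Vector_Spaces.linear cscale cscale ?f"
    by unfold_locales (simp_all add: br matrix_add_ldistrib matrix_mult_add_left cscale_mult
        cmat.scale_right_distrib cmat.scale_right_diff_distrib algebra_simps)
  then have "killing_form (lie_algebra SO7C) X Y = (\<Sum>i\<in>?I. \<Sum>j\<in>?I. ?f (skew_unit i j) $ i $ j) / 2"
    unfolding killing_form_def by (rule trace_on_SO7C) (intro bracket_SO7C X Y)
  also have "(\<Sum>i\<in>?I. \<Sum>j\<in>?I. ?f (skew_unit i j) $ i $ j)
      = (\<Sum>i\<in>?I. \<Sum>j\<in>?I. (if i = j then 0 else (X ** Y) $ i $ i + (Y ** X) $ j $ j) + 2 * (X $ i $ j * Y $ i $ j))"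
  proof (intro sum.cong refl)
    fix i j
    note e = lie_algebra_SO7C_entries(2)[OF X] lie_algebra_SO7C_entries(2)[OF Y]
    have m: "(A ** (skew_unit i j ** C)) $ i $ j = A $ i $ i * C $ j $ j - A $ i $ j * C $ i $ j"
      for A C :: "complex ^ 8 ^ 8"
    proof -
      have "(A ** (skew_unit i j ** C)) $ i $ j = (\<Sum>m\<in>UNIV. (if m = i then A $ i $ m * C $ j $ j else 0))
          - (\<Sum>m\<in>UNIV. (if m = j then A $ i $ m * C $ i $ j else 0))"
        unfolding sum_subtractf[symmetric]
        by (subst matrix_matrix_mult_def) (auto simp: skew_unit_mult intro!: sum.cong)
      then show ?thesis by simp
    qed
    show "?f (skew_unit i j) $ i $ j =
        (if i = j then 0 else (X ** Y) $ i $ i + (Y ** X) $ j $ j) + 2 * (X $ i $ j * Y $ i $ j)"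
      unfolding br by (simp add: m skew_unit_mult e)
  qed
  also have "\<dots> = (\<Sum>i\<in>?I. \<Sum>j\<in>?I. if i = j then 0 else (X ** Y) $ i $ i + (Y ** X) $ j $ j) + 2 * ?S"
  proof -
    have "(\<Sum>i\<in>?I. \<Sum>j\<in>?I. X $ i $ j * Y $ i $ j) = ?S"
      by (intro sum.mono_neutral_cong_left sum.mono_neutral_left)
        (auto simp: lie_algebra_SO7C_entries(3,4)[OF X])
    then show ?thesis by (simp add: sum.distrib flip: sum_distrib_left)
  qed
  \<comment> \<open>Among the seven nonzero indices each one is paired with six others.\<close>
  also have "(\<Sum>i\<in>?I. \<Sum>j\<in>?I. if i = j then 0 else (X ** Y) $ i $ i + (Y ** X) $ j $ j)
      = 6 * (\<Sum>i\<in>?I. (X ** Y) $ i $ i) + 6 * (\<Sum>i\<in>?I. (Y ** X) $ i $ i)"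
  proof -
    have I: "?I = {1, 2, 3, 4, 5, 6, 7}" using UNIV_8 by auto
    show ?thesis unfolding I by simp
  qed
  also have "(\<Sum>i\<in>?I. (X ** Y) $ i $ i) = - ?S"
    by (rule trace_mult_SO7C[OF X Y])
  also have "(\<Sum>i\<in>?I. (Y ** X) $ i $ i) = - ?S"
    using trace_mult_SO7C[OF Y X] by (simp add: mult.commute)
  finally show ?thesis by simp
qed

lemma \<aa>\<^sub>0_killing:
  assumes "Y \<in> lie_algebra G2C"
  shows "killing_form (lie_algebra SO7C) (diag_delta t) Y = 0"
proof -
  have Y: "Y \<in> lie_algebra SO7C" using assms lie_algebra_mono[OF G2C_subset_SO7C] by blast
  have X: "diag_delta t \<in> lie_algebra SO7C"
    using lie_algebra_mono[OF A\<^sub>0_subset_SO7C] by (auto simp: lie_algebra_A\<^sub>0 \<aa>\<^sub>0_def)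
  have "(\<Sum>i\<in>UNIV. \<Sum>j\<in>UNIV. diag_delta t $ i $ j * Y $ i $ j)
      = \<i> * complex_of_real t * (Y $ 3 $ 2 - Y $ 2 $ 3 + (Y $ 5 $ 4 - Y $ 4 $ 5) + (Y $ 7 $ 6 - Y $ 6 $ 7))"
    by (simp add: sum_8 diag_delta_def algebra_simps)
  also have "\<dots> = \<i> * complex_of_real t * (2 * (Y $ 3 $ 2 + Y $ 5 $ 4 + Y $ 7 $ 6))"
    using lie_algebra_SO7C_entries(1)[OF Y, of 2 3] lie_algebra_SO7C_entries(1)[OF Y, of 4 5]
      lie_algebra_SO7C_entries(1)[OF Y, of 6 7] by simp
  finally show ?thesis
    by (simp add: killing_form_SO7C[OF X Y] lie_algebra_G2C_entries[OF assms])
qed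

text \<open>Removing the factor \<open>\<i>\<close> leaves a real multiple of
  \<open>J\<^sub>0\<close>, which generates real rotations.\<close>

lemma \<aa>\<^sub>0_compact: "diag_delta t \<in> cscale \<i> ` lie_algebra SO7"
proof
  show "diag_delta t = cscale \<i> (cscale (complex_of_real t) J\<^sub>0)"
    by (simp add: diag_delta_eq)
  have "s *\<^sub>R cscale (complex_of_real t) J\<^sub>0 = cscale (complex_of_real (s * t)) J\<^sub>0" for s
    by (simp add: cscale_scaleR) (simp add: scaleR_conv_of_real)
  then show "cscale (complex_of_real t) J\<^sub>0 \<in> lie_algebra SO7"
    by (simp only: lie_algebra_def mem_Collect_eq mat_exp_J\<^sub>0 rot_SO7 simp_thms)
qed

theorem theorem5p2:
  shows "\<aa>\<^sub>0 \<subseteq> cscale \<i> ` lie_algebra SO7 \<inter> killing_complement (lie_algebra SO7C) (lie_algebra G2C)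
    \<and> comm_group (matrix_monoid A\<^sub>0)
    \<and> dim (lie_algebra A\<^sub>0) = 1
    \<and> SO7C = {k ** a ** h | k a h. k \<in> SO7 \<and> a \<in> A\<^sub>0 \<and> h \<in> G2C}"
proof (intro conjI subsetI IntI)
  fix X assume "X \<in> \<aa>\<^sub>0"
  then obtain t where X: "X = diag_delta t" by (auto simp: \<aa>\<^sub>0_def)
  show "X \<in> cscale \<i> ` lie_algebra SO7" unfolding X by (rule \<aa>\<^sub>0_compact)
  have "X \<in> lie_algebra SO7C"
    using \<open>X \<in> \<aa>\<^sub>0\<close> lie_algebra_mono[OF A\<^sub>0_subset_SO7C] by (auto simp: lie_algebra_A\<^sub>0)
  then show "X \<in> killing_complement (lie_algebra SO7C) (lie_algebra G2C)"
    by (simp add: killing_complement_def X \<aa>\<^sub>0_killing)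
qed (simp_all only: comm_group_A\<^sub>0 lie_algebra_A\<^sub>0 dim_\<aa>\<^sub>0 SO7C_eq[symmetric])

end
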